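(* Let $\lambda>0$ and $0<\alpha\le1$. For $u\ge0$, the moment generating function $\hat M_\alpha(u,t)=\mathbb E\big(e^{-u\hat N_\alpha(t)}\big)$ solves the fractional differential equation $$\frac{\partial^{2\alpha}}{\partial t^{2\alpha}}\hat M_\alpha(u,t)+2\lambda\frac{\partial^\alpha}{\partial t^\alpha}\hat M_\alpha(u,t)=\lambda^2(e^{-u}-1)\hat M_\alpha(u,t),\qquad t>0,$$ with initial conditions $\hat M_\alpha(u,0)=1$ and, for $1/2<\alpha\le1$, $\frac{\partial}{\partial t}\hat M_\alpha(u,0)=0$; and its solution is given by $$\hat M_\alpha(u,t)=\frac{\sqrt{e^{-u}}+1}{2\sqrt{e^{-u}}}E_{\alpha,1}\big(-\lambda(1-\sqrt{e^{-u}})t^\alpha\big)+\frac{\sqrt{e^{-u}}-1}{2\sqrt{e^{-u}}}E_{\alpha,1}\big(-\lambda(1+\sqrt{e^{-u}})t^\alpha\big).$$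
   Context: Three-parameter Mittag-Leffler function: $E_{\alpha,\beta}^{\gamma}(x)=\frac{1}{\Gamma(\gamma)}\sum_{j=0}^\infty\frac{\Gamma(j+\gamma)x^j}{j!\,\Gamma(j\alpha+\beta)}$ for $\alpha,\beta,\gamma>0$, $x\in\mathbb R$; $E_{\alpha,\beta}=E_{\alpha,\beta}^1$. For $\lambda>0$ and $0<\alpha\le1$, $\{\hat N_\alpha(t)\}_{t\ge0}$ is the renewal counting process with $\hat N_\alpha(0)=0$ whose i.i.d. interarrival times have density $\lambda^2t^{2\alpha-1}E^2_{\alpha,2\alpha}(-\lambda t^\alpha)$, $t>0$. Its probability mass function is, for $n\ge0$, $$\Pr\{\hat N_\alpha(t)=n\}=\lambda^{2n}t^{2n\alpha}E_{\alpha,2n\alpha+1}^{2n+1}(-\lambda t^\alpha)+\lambda^{2n+1}t^{(2n+1)\alpha}E_{\alpha,(2n+1)\alpha+1}^{2n+2}(-\lambda t^\alpha).$$ $\frac{\partial^\gamma}{\partial t^\gamma}$ is the Caputo fractional derivative in $t$: for $0<\gamma<1$, $\frac{\mathrm d^\gamma}{\mathrm dt^\gamma}f(t)=\frac1{\Gamma(1-\gamma)}\int_0^t(t-s)^{-\gamma}f'(s)\,\mathrm ds$; for $1<\gamma<2$, $\frac{\mathrm d^\gamma}{\mathrm dt^\gamma}f(t)=\frac1{\Gamma(2-\gamma)}\int_0^t(t-s)^{1-\gamma}f''(s)\,\mathrm ds$; for $\gamma=1,2$ it is the ordinary derivative of order $\gamma$. *)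

theory Defs
  imports "HOL-Probability.Probability"
begin

definition mittag_leffler3 :: "real \<Rightarrow> real \<Rightarrow> real \<Rightarrow> real \<Rightarrow> real" where
  "mittag_leffler3 \<alpha> \<beta> \<gamma> x =
     1 / Gamma \<gamma> * (\<Sum>j. Gamma (real j + \<gamma>) * x ^ j / (fact j * Gamma (real j * \<alpha> + \<beta>)))"

definition mittag_leffler :: "real \<Rightarrow> real \<Rightarrow> real \<Rightarrow> real" where
  "mittag_leffler \<alpha> \<beta> x = mittag_leffler3 \<alpha> \<beta> 1 x"

(* For 1 < \<gamma> < 2 the second derivative of f is deriv (deriv f).  The value is meaningful only
   together with caputo_differentiable below: deriv and the Lebesgue integral are total. *)
definition caputo :: "real \<Rightarrow> (real \<Rightarrow> real) \<Rightarrow> real \<Rightarrow> real" where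
  "caputo \<gamma> f t =
     (if 0 < \<gamma> \<and> \<gamma> < 1 then
        1 / Gamma (1 - \<gamma>) * (LINT s:{0<..<t}|lborel. (t - s) powr (- \<gamma>) * deriv f s)
      else if \<gamma> = 1 then deriv f t
      else if 1 < \<gamma> \<and> \<gamma> < 2 then
        1 / Gamma (2 - \<gamma>) * (LINT s:{0<..<t}|lborel. (t - s) powr (1 - \<gamma>) * deriv (deriv f) s)
      else if \<gamma> = 2 then deriv (deriv f) t
      else undefined)"

(* All derivatives and integrals occurring in caputo \<gamma> f t exist. *)
definition caputo_differentiable :: "real \<Rightarrow> (real \<Rightarrow> real) \<Rightarrow> real \<Rightarrow> bool" where
  "caputo_differentiable \<gamma> f t \<longleftrightarrow>
     (if 0 < \<gamma> \<and> \<gamma> < 1 then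
        (\<forall>s\<in>{0<..<t}. f field_differentiable (at s)) \<and>
        set_integrable lborel {0<..<t} (\<lambda>s. (t - s) powr (- \<gamma>) * deriv f s)
      else if \<gamma> = 1 then f field_differentiable (at t)
      else if 1 < \<gamma> \<and> \<gamma> < 2 then
        (\<forall>s\<in>{0<..<t}. f field_differentiable (at s) \<and> deriv f field_differentiable (at s)) \<and>
        set_integrable lborel {0<..<t} (\<lambda>s. (t - s) powr (1 - \<gamma>) * deriv (deriv f) s)
      else if \<gamma> = 2 then
        (\<forall>\<^sub>F s in nhds t. f field_differentiable (at s)) \<and> deriv f field_differentiable (at t)
      else False)"

(* The sign condition is part of f being a density: ennreal on its own would silently replace
   negative values by 0. *)
definition has_real_density :: "'a measure \<Rightarrow> ('a \<Rightarrow> real) \<Rightarrow> (real \<Rightarrow> real) \<Rightarrow> bool" where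
  "has_real_density M X f \<longleftrightarrow>
     distributed M lborel X (\<lambda>x. ennreal (f x)) \<and> (AE x in lborel. 0 \<le> f x)"

(* T i is the (i+1)-st interarrival time, so the n-th renewal epoch is the sum of T i over i < n,
   and N t counts the epochs n \<ge> 1 in [0, t].  Interarrival times are positive almost surely when
   f vanishes on {..0}, so N 0 = 0 almost surely; card assigns 0 to an infinite set, which
   only matters on the null event of an explosion. *)
definition renewal_process ::
    "'a measure \<Rightarrow> (real \<Rightarrow> real) \<Rightarrow> (real \<Rightarrow> 'a \<Rightarrow> nat) \<Rightarrow> bool" where
  "renewal_process M f N \<longleftrightarrow>
     prob_space M \<and>
     (\<exists>T :: nat \<Rightarrow> 'a \<Rightarrow> real.
        prob_space.indep_vars M (\<lambda>_. borel) T UNIV \<and>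
        (\<forall>i. has_real_density M (T i) f) \<and>
        (\<forall>t\<ge>0. \<forall>\<omega>\<in>space M. N t \<omega> = card {n. 1 \<le> n \<and> (\<Sum>i<n. T i \<omega>) \<le> t}))"

definition interarrival_density :: "real \<Rightarrow> real \<Rightarrow> real \<Rightarrow> real" where
  "interarrival_density lam \<alpha> t =
     (if 0 < t
      then lam\<^sup>2 * t powr (2 * \<alpha> - 1) * mittag_leffler3 \<alpha> (2 * \<alpha>) 2 (- lam * t powr \<alpha>)
      else 0)"

definition moment_gen :: "'a measure \<Rightarrow> (real \<Rightarrow> 'a \<Rightarrow> nat) \<Rightarrow> real \<Rightarrow> real \<Rightarrow> real" where
  "moment_gen M N u t = prob_space.expectation M (\<lambda>\<omega>. exp (- u * real (N t \<omega>)))"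

end

theory Submission imports Defs begin

text \<open>
  Write $e_x(t) = t^{x-1}/\Gamma(x)$. The Beta integral says $e_x * e_y = e_{x+y}$ for convolution on
  $(0,t)$, and $e_x' = e_{x-1}$. Hence the map that sends a power series $\sum_k a_k X^k$ to
  the function $\sum_k a_k e_{k\alpha+\beta}(t)$ turns multiplication of power series into convolution and
  multiplication by $X$ into fractional integration of order $\alpha$. Everything in the theorem is in
  the image of this map (\<open>rl_series\<close>), and every identity reduces to algebra with rational power series:
  the Mittag-Leffler function $E_{\alpha,1}(x t^\alpha)$ comes from $1/(1-xX)$ with $\beta = 1$,
  the interarrival density from $w = (\lambda X)^2/(1+\lambda X)^2$ with $\beta = 0$.

  With $q = e^{-u}$ and $p = \sqrt q$, conditioning on the first arrival suggests that the moment
  generating function comes from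
  $m = (1-w)/(1-qw) = 1 + X^2 n$, where
  $n = \lambda^2(q-1)/((1+\lambda(1-p)X)(1+\lambda(1+p)X))$. The partial fractions of $m$ are the closed form,
  and clearing denominators gives $n + 2\lambda X n = \lambda^2(q-1)m$. Because $m$ has no linear term, the Caputo
  derivatives of orders $\alpha$ and $2\alpha$ of the function of $m$ are the functions of $Xn$ and $n$, again with $\beta = 1$
  (\<open>caputo_rl_series\<close>), so this last identity is the fractional differential equation.

  It remains to identify the moment generating function with the function $G$ of $m$. Uniqueness
  for the renewal equation is obtained by iteration. If $S_n$ is the $n$-th epoch and $p_n = \Pr(S_n \le t)$, then
  $g_n = E[G(t-S_n); S_n\le t]$ satisfies $g_n - p_n = q g_{n+1} - p_{n+1}$, whence
  $G(t) = \sum_{n<k} q^n (p_n-p_{n+1}) + q^k g_k$, whose remainder is bounded by a multiple of $p_k$. A Chernoff bound gives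
  $p_k \to 0$, and the sum is $E[q^{N}]$ up to an error of at most $p_k$
  (\<open>expectation_power_renewal_count\<close>).
\<close>

section \<open>Growth of the Gamma function\<close>

text \<open>
  Restricting Euler's integral to $[A,A+1]$ gives $\Gamma(x+1)\ge A^x e^{-(A+1)}$ for every $A$, so the reciprocal
  Gamma function decays faster than any exponential. Passing from $\Gamma(x+1)$ to $\Gamma(x)$ costs a factor $x$;
  it is absorbed by $e^x$, which is why $A$ is chosen as $eB$.
\<close>

lemma rGamma_decay:
  fixes B :: real
  assumes "0 < B"
  obtains K where "\<And>x. 0 < x \<Longrightarrow> rGamma x \<le> K * B powr (- x)"
proof
  define A where "A = exp 1 * B"
  have A: "0 < A" using assms by (simp add: A_def)
  fix x :: real assume x: "0 < x"
  have sub: "((\<lambda>t. t powr x / exp t) has_integral integral {A..A+1} (\<lambda>t. t powr x / exp t)) {A..A+1}"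
    using A by (intro integrable_integral integrable_continuous_real continuous_intros) auto
  have "A powr x / exp (A + 1) = integral {A..A+1} (\<lambda>t. A powr x / exp (A + 1))" by simp
  also have "\<dots> \<le> integral {A..A+1} (\<lambda>t. t powr x / exp t)"
    using A x sub by (intro integral_le frac_le powr_mono2) auto
  also have "\<dots> \<le> Gamma (x + 1)"
    using Gamma_integral_real[of "x + 1"] x A sub
    by (intro has_integral_subset_le[OF _ sub, where t = "{0..}"]) auto
  finally have le: "A powr x / exp (A + 1) \<le> Gamma (x + 1)" .
  have "rGamma x = x * rGamma (x + 1)" by (simp add: rGamma_plus1)
  also have "\<dots> \<le> exp x * (exp (A + 1) * A powr (- x))"
  proof (intro mult_mono)
    show "x \<le> exp x" using exp_ge_add_one_self[of x] by linarith
    have "rGamma (x + 1) = 1 / Gamma (x + 1)" by (simp add: rGamma_inverse_Gamma divide_inverse)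
    also have "\<dots> \<le> 1 / (A powr x / exp (A + 1))"
      using le A by (intro divide_left_mono) (auto intro!: mult_pos_pos Gamma_real_pos simp: x add_pos_pos)
    finally show "rGamma (x + 1) \<le> exp (A + 1) * A powr (- x)"
      by (simp add: powr_minus field_simps)
    show "0 \<le> rGamma (x + 1)"
      using x by (simp add: rGamma_inverse_Gamma less_imp_le)
  qed simp
  also have "\<dots> = exp (A + 1) * B powr (- x)"
    using assms by (simp add: A_def powr_mult powr_def exp_add[symmetric] ln_mult algebra_simps)
  finally show "rGamma x \<le> exp (exp 1 * B + 1) * B powr (- x)" by (simp add: A_def)
qed

text \<open>
  The superexponential decay makes every series with geometrically bounded coefficients entire. The base $B$ of the
  decay estimate is chosen such that $B^\alpha = R/r$ for some $r$ inside the disc of convergence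
  of $a$, which turns the estimate into a comparison with $\sum_k |a_k| r^k$.
\<close>

lemma summable_rGamma_powser:
  fixes a :: "real fps" and \<alpha> \<beta> R :: real
  assumes "0 < \<alpha>" "0 < fps_conv_radius a" "0 < R"
  shows "summable (\<lambda>k. \<bar>fps_nth a k\<bar> * \<bar>rGamma (real k * \<alpha> + \<beta>)\<bar> * R ^ k)"
proof -
  obtain r where r: "0 < r" "ereal r < fps_conv_radius a"
    using ereal_dense2[OF assms(2)] by auto
  have sm: "summable (\<lambda>k. norm (fps_nth a k * r ^ k))"
    using r by (intro abs_summable_in_conv_radius) (auto simp: fps_conv_radius_def)
  define B where "B = (R / r) powr (1 / \<alpha>)"
  have B: "0 < B" using assms r by (simp add: B_def)
  have B_pow: "B powr (- (real k * \<alpha> + \<beta>)) * R ^ k = r ^ k * B powr (- \<beta>)" for k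
  proof -
    have "B powr (real k * \<alpha>) = (R / r) ^ k"
      using assms r by (simp add: B_def powr_powr powr_realpow)
    moreover have "B powr (- (real k * \<alpha> + \<beta>)) = B powr (- \<beta>) / B powr (real k * \<alpha>)"
      by (simp add: powr_diff[symmetric] algebra_simps)
    ultimately have "B powr (- (real k * \<alpha> + \<beta>)) * R ^ k = B powr (- \<beta>) / (R / r) ^ k * R ^ k"
      by (simp only:)
    then show ?thesis using assms r by (simp add: power_divide)
  qed
  obtain K where K: "\<And>x. 0 < x \<Longrightarrow> rGamma x \<le> K * B powr (- x)"
    using rGamma_decay[OF B] by blast
  show ?thesis
  proof (rule summable_comparison_test_ev)
    show "summable (\<lambda>k. norm (fps_nth a k * r ^ k) * (K * B powr (- \<beta>)))"
      using sm by (rule summable_mult2)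
    have "filterlim (\<lambda>k. real k * \<alpha> + \<beta>) at_top sequentially"
      using assms by real_asymp
    then have "\<forall>\<^sub>F k in sequentially. 0 < real k * \<alpha> + \<beta>"
      by (rule eventually_compose_filterlim[OF eventually_gt_at_top])
    then show "\<forall>\<^sub>F k in sequentially. norm (\<bar>fps_nth a k\<bar> * \<bar>rGamma (real k * \<alpha> + \<beta>)\<bar> * R ^ k)
        \<le> norm (fps_nth a k * r ^ k) * (K * B powr (- \<beta>))"
    proof eventually_elim
      case (elim k)
      have "\<bar>rGamma (real k * \<alpha> + \<beta>)\<bar> = rGamma (real k * \<alpha> + \<beta>)"
        using elim by (simp add: rGamma_inverse_Gamma Gamma_real_pos less_imp_le)
      then have "\<bar>rGamma (real k * \<alpha> + \<beta>)\<bar> * R ^ k \<le> K * (B powr (- (real k * \<alpha> + \<beta>)) * R ^ k)"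
        using K[OF elim] assms(3) by (simp add: mult_right_mono mult.assoc[symmetric])
      then have "\<bar>fps_nth a k\<bar> * (\<bar>rGamma (real k * \<alpha> + \<beta>)\<bar> * R ^ k)
          \<le> \<bar>fps_nth a k\<bar> * (K * (r ^ k * B powr (- \<beta>)))"
        unfolding B_pow by (rule mult_left_mono) simp
      then show ?case
        using assms(3) r by (simp add: abs_mult power_abs mult_ac)
    qed
  qed
qed

section \<open>Series of Riemann-Liouville kernels\<close>

text \<open>
  The Riemann-Liouville kernel of order $x$. Using the entire function $1/\Gamma$ makes the kernels of order
  $0$ and $-1$ vanish, so that differentiation lowers the order without exceptions.
\<close>

definition rl_kernel :: "real \<Rightarrow> real \<Rightarrow> real" where
  "rl_kernel x t = t powr (x - 1) * rGamma x"

text \<open>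
  The function represented by a formal power series, in which the formal variable stands for fractional integration of order
  \<open>\<alpha>\<close>, applied to the kernel of order \<open>\<beta>\<close>.
\<close>

definition rl_series :: "real \<Rightarrow> real \<Rightarrow> real fps \<Rightarrow> real \<Rightarrow> real" where
  "rl_series \<alpha> \<beta> a t = (\<Sum>k. fps_nth a k * rl_kernel (real k * \<alpha> + \<beta>) t)"

lemma rl_kernel_nonneg: "0 < x \<Longrightarrow> 0 \<le> rl_kernel x t"
  by (simp add: rl_kernel_def rGamma_inverse_Gamma less_imp_le)

lemma rl_kernel_powser:
  "0 < t \<Longrightarrow> rl_kernel (real k * \<alpha> + \<beta>) t = t powr (\<beta> - 1) * (rGamma (real k * \<alpha> + \<beta>) * (t powr \<alpha>) ^ k)"
proof -
  assume t: "0 < t"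
  have "t powr (real k * \<alpha> + \<beta> - 1) = t powr (\<beta> - 1) * t powr (real k * \<alpha>)"
    by (simp add: powr_add[symmetric] algebra_simps)
  also have "t powr (real k * \<alpha>) = (t powr \<alpha>) ^ k"
    using t by (simp add: powr_powr[symmetric] powr_realpow[symmetric] mult.commute)
  finally show ?thesis by (simp add: rl_kernel_def mult_ac)
qed

lemma rl_series_abs_summable:
  assumes "0 < \<alpha>" "0 < fps_conv_radius a" "0 < t"
  shows "summable (\<lambda>k. \<bar>fps_nth a k * rl_kernel (real k * \<alpha> + \<beta>) t\<bar>)"
proof -
  have "summable (\<lambda>k. t powr (\<beta> - 1) * (\<bar>fps_nth a k\<bar> * \<bar>rGamma (real k * \<alpha> + \<beta>)\<bar> * (t powr \<alpha>) ^ k))"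
    using assms by (intro summable_mult summable_rGamma_powser) auto
  then show ?thesis
    by (rule summable_cong[THEN iffD1, rotated])
       (use assms(3) in \<open>simp add: rl_kernel_powser abs_mult power_abs\<close>)
qed

lemma rl_series_sums:
  assumes "0 < \<alpha>" "0 < fps_conv_radius a" "0 < t"
  shows "(\<lambda>k. fps_nth a k * rl_kernel (real k * \<alpha> + \<beta>) t) sums rl_series \<alpha> \<beta> a t"
  unfolding rl_series_def
  by (rule summable_sums[OF summable_rabs_cancel[OF rl_series_abs_summable[OF assms]]])

lemma rl_series_add:
  assumes "0 < \<alpha>" "0 < fps_conv_radius a" "0 < fps_conv_radius b" "0 < t"
  shows "rl_series \<alpha> \<beta> (a + b) t = rl_series \<alpha> \<beta> a t + rl_series \<alpha> \<beta> b t"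
  using sums_add[OF rl_series_sums[OF assms(1,2,4)] rl_series_sums[OF assms(1,3,4)], of \<beta> \<beta>]
  by (simp add: rl_series_def sums_iff algebra_simps)

lemma rl_series_cmult:
  assumes "0 < \<alpha>" "0 < fps_conv_radius a" "0 < t"
  shows "rl_series \<alpha> \<beta> (fps_const c * a) t = c * rl_series \<alpha> \<beta> a t"
  using sums_mult[OF rl_series_sums[OF assms], of c \<beta>]
  by (simp add: rl_series_def sums_iff algebra_simps)

lemma rl_series_one: "rl_series \<alpha> \<beta> 1 t = rl_kernel \<beta> t"
proof -
  have "(\<lambda>k. fps_nth (1::real fps) k * rl_kernel (real k * \<alpha> + \<beta>) t) =
      (\<lambda>k. if k = 0 then rl_kernel (real k * \<alpha> + \<beta>) t else 0)"
    by auto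
  then show ?thesis
    unfolding rl_series_def using sums_single[of 0 "\<lambda>k. rl_kernel (real k * \<alpha> + \<beta>) t"]
    by (simp add: sums_iff)
qed

text \<open>
  The rule that makes the calculus work: the formal variable only shifts the order, so every power series without
  low-order terms can be traded for a series of less singular type.
\<close>

lemma rl_series_X_mult: 
  assumes "0 < \<alpha>" "0 < fps_conv_radius a" "0 < t"
  shows "rl_series \<alpha> \<beta> (fps_X * a) t = rl_series \<alpha> (\<beta> + \<alpha>) a t"
proof -
  have "(\<lambda>k. fps_nth (fps_X * a) (Suc k) * rl_kernel (real (Suc k) * \<alpha> + \<beta>) t) sums 
     rl_series \<alpha> (\<beta> + \<alpha>) a t"
    using rl_series_sums[OF assms, of "\<beta> + \<alpha>"] by (simp add: algebra_simps)
  then have "(\<lambda>k. fps_nth (fps_X * a) k * rl_kernel (real k * \<alpha> + \<beta>) t) sums 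
     rl_series \<alpha> (\<beta> + \<alpha>) a t"
    by (subst (asm) sums_Suc_iff) simp
  then show ?thesis by (simp add: rl_series_def sums_iff)
qed

lemma rl_series_X2_mult: 
  assumes "0 < \<alpha>" "0 < fps_conv_radius a" "0 < t"
  shows "rl_series \<alpha> \<beta> (fps_X\<^sup>2 * a) t = rl_series \<alpha> (\<beta> + 2 * \<alpha>) a t"
proof -
  have "0 < fps_conv_radius (fps_X * a)"
    using fps_conv_radius_mult[of fps_X a] assms(2) by auto
  then show ?thesis using assms 
    by (simp add: power2_eq_square mult.assoc rl_series_X_mult algebra_simps)
qed

text \<open>
  Monotonicity of $s^{k\alpha}$ bounds all terms at $s$ by those at $t$. For $\beta = 1$ this is local boundedness,
  for $\beta > 1$ it is the order of vanishing at the origin.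
\<close>

lemma rl_series_bound:
  assumes "0 < \<alpha>" "0 < \<beta>" "0 < fps_conv_radius a" "0 < s" "s \<le> t"
  shows "\<bar>rl_series \<alpha> \<beta> a s\<bar> \<le> (s / t) powr (\<beta> - 1) * (\<Sum>k. \<bar>fps_nth a k * rl_kernel (real k * \<alpha> + \<beta>) t\<bar>)"
proof -
  have t: "0 < t" using assms by simp
  have "\<bar>rl_series \<alpha> \<beta> a s\<bar> \<le> (\<Sum>k. \<bar>fps_nth a k * rl_kernel (real k * \<alpha> + \<beta>) s\<bar>)"
    unfolding rl_series_def using assms by (intro summable_rabs rl_series_abs_summable) 
  also have "\<dots> \<le> (\<Sum>k. (s / t) powr (\<beta> - 1) * \<bar>fps_nth a k * rl_kernel (real k * \<alpha> + \<beta>) t\<bar>)"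
  proof (intro suminf_le summable_mult rl_series_abs_summable)
    fix k
    have "(s powr \<alpha>) ^ k \<le> (t powr \<alpha>) ^ k"
      using assms by (intro power_mono powr_mono2) auto
    then have "s powr (\<beta> - 1) * (\<bar>rGamma (real k * \<alpha> + \<beta>)\<bar> * (s powr \<alpha>) ^ k)
       \<le> (s / t) powr (\<beta> - 1) * (t powr (\<beta> - 1) * (\<bar>rGamma (real k * \<alpha> + \<beta>)\<bar> * (t powr \<alpha>) ^ k))"
      using assms t by (simp add: powr_divide mult_left_mono)
    then have "\<bar>rl_kernel (real k * \<alpha> + \<beta>) s\<bar> \<le> (s / t) powr (\<beta> - 1) * \<bar>rl_kernel (real k * \<alpha> + \<beta>) t\<bar>"
      unfolding rl_kernel_powser[OF assms(4)] rl_kernel_powser[OF t] abs_mult by simp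
    from mult_left_mono[OF this abs_ge_zero[of "fps_nth a k"]]
    show "\<bar>fps_nth a k * rl_kernel (real k * \<alpha> + \<beta>) s\<bar>
        \<le> (s / t) powr (\<beta> - 1) * \<bar>fps_nth a k * rl_kernel (real k * \<alpha> + \<beta>) t\<bar>"
      by (simp only: abs_mult mult_ac)
  qed (use assms t in auto)
  also have "\<dots> = (s / t) powr (\<beta> - 1) * (\<Sum>k. \<bar>fps_nth a k * rl_kernel (real k * \<alpha> + \<beta>) t\<bar>)"
    using assms t by (intro suminf_mult rl_series_abs_summable)
  finally show ?thesis .
qed

text \<open>
  Up to the factor $t^{\beta-1}$ the series is a power series in $t^\alpha$, which may be differentiated term
  by term; the functional equation of $1/\Gamma$ then collects the two summands of the product rule. It holds for every
  real \<open>\<beta>\<close>, because that functional equation has no exceptional points.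
\<close>

lemma rl_series_has_derivative:
  assumes "0 < \<alpha>" "0 < fps_conv_radius a" "0 < t"
  shows "(rl_series \<alpha> \<beta> a has_real_derivative rl_series \<alpha> (\<beta> - 1) a t) (at t)"
proof -
  define c where "c k = fps_nth a k * rGamma (real k * \<alpha> + \<beta>)" for k
  define P where "P z = (\<Sum>k. c k * z ^ k)" for z
  define P' where "P' z = (\<Sum>k. diffs c k * z ^ k)" for z
  have sm: "summable (\<lambda>k. c k * y ^ k)" for y
  proof -
    have "summable (\<lambda>k. \<bar>fps_nth a k\<bar> * \<bar>rGamma (real k * \<alpha> + \<beta>)\<bar> * (\<bar>y\<bar> + 1) ^ k)"
      using assms by (intro summable_rGamma_powser) auto
    then show ?thesis
      by (rule summable_comparison_test[rotated])
         (auto simp: c_def abs_mult power_abs intro!: mult_left_mono power_mono exI[of _ 0])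
  qed
  have P: "(P has_real_derivative P' z) (at z)" for z
    unfolding P_def P'_def by (rule termdiffs_strong_converges_everywhere[OF sm])
  have eq: "rl_series \<alpha> \<beta> a s = s powr (\<beta> - 1) * P (s powr \<alpha>)" if "0 < s" for s
  proof -
    have "fps_nth a k * rl_kernel (real k * \<alpha> + \<beta>) s = s powr (\<beta> - 1) * (c k * (s powr \<alpha>) ^ k)" for k
      using that by (simp add: rl_kernel_powser c_def)
    then show ?thesis
      unfolding rl_series_def P_def by (simp only: suminf_mult[OF sm])
  qed
  define z where "z = t powr \<alpha>"
  \<comment> \<open>Multiplying the derived power series by $z$ removes its index shift.\<close>
  have "(\<lambda>k. real k * c k * z ^ (k - Suc 0)) sums P' z"
    using termdiff_converges_all[OF sm, of z] unfolding P'_def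
    by (intro diffs_equiv)
  then have "(\<lambda>k. z * (real k * c k * z ^ (k - Suc 0))) sums (z * P' z)"
    by (rule sums_mult)
  moreover have "z * (real k * c k * z ^ (k - Suc 0)) = real k * c k * z ^ k" for k
    by (cases k) auto
  ultimately have zP': "(\<lambda>k. real k * c k * z ^ k) sums (z * P' z)" by simp
  have "(\<lambda>k. (\<beta> - 1) * (c k * z ^ k) + \<alpha> * (real k * c k * z ^ k)) sums ((\<beta> - 1) * P z + \<alpha> * (z * P' z))"
    unfolding P_def by (intro sums_add sums_mult zP' summable_sums sm)
  then have sums: "(\<lambda>k. t powr (\<beta> - 2) * ((\<beta> - 1) * (c k * z ^ k) + \<alpha> * (real k * c k * z ^ k))) sums
     (t powr (\<beta> - 2) * ((\<beta> - 1) * P z + \<alpha> * (z * P' z)))"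
    by (rule sums_mult)
  have "t powr (\<beta> - 2) * ((\<beta> - 1) * (c k * z ^ k) + \<alpha> * (real k * c k * z ^ k))
      = fps_nth a k * rl_kernel (real k * \<alpha> + (\<beta> - 1)) t" for k
  proof -
    have "rGamma (real k * \<alpha> + (\<beta> - 1)) = (real k * \<alpha> + \<beta> - 1) * rGamma (real k * \<alpha> + \<beta>)"
      using rGamma_plus1[of "real k * \<alpha> + (\<beta> - 1)"] by (simp add: algebra_simps)
    moreover have "\<beta> - 1 - 1 = \<beta> - 2" by simp
    ultimately show ?thesis
      unfolding rl_kernel_powser[OF assms(3)] c_def z_def[symmetric]
      by (simp only:) (simp add: algebra_simps)
  qed
  then have val: "rl_series \<alpha> (\<beta> - 1) a t = t powr (\<beta> - 2) * ((\<beta> - 1) * P z + \<alpha> * (z * P' z))"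
    using sums by (simp add: rl_series_def sums_iff)
  have "((\<lambda>s. s powr (\<beta> - 1) * P (s powr \<alpha>)) has_real_derivative rl_series \<alpha> (\<beta> - 1) a t) (at t)"
    unfolding val
    apply (rule derivative_eq_intros DERIV_chain2[OF P] refl has_real_derivative_powr assms)+
    using assms(3) by (simp add: z_def powr_diff power2_eq_square field_simps)
  then show ?thesis
    by (rule has_field_derivative_transform_within_open[where S = "{0<..}"]) (use assms eq in auto)
qed

text \<open>
  This is the Beta integral, rescaled from $(0,1)$ to $(0,t)$.
\<close>

lemma rl_kernel_convolution:
  assumes "0 < x" "0 < y" "0 < t"
  shows "set_integrable lborel {0<..<t} (\<lambda>s. rl_kernel x s * rl_kernel y (t - s))"
    and "(LINT s:{0<..<t}|lborel. rl_kernel x s * rl_kernel y (t - s)) = rl_kernel (x + y) t"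
proof -
  let ?g = "\<lambda>s. s powr (x - 1) * (1 - s) powr (y - 1)"
  have int01: "set_integrable lborel {0<..<1} ?g"
    using integrable_Beta[OF assms(1,2)] by (rule set_integrable_subset) auto
  have "(?g has_integral Beta x y) {0<..<1}"
    using has_integral_Beta_real[OF assms(1,2)] by (simp add: has_integral_Icc_iff_Ioo)
  then have val01: "(LINT s:{0<..<1}|lborel. ?g s) = Beta x y"
    using set_borel_integral_eq_integral(2)[OF int01] by (simp add: integral_unique)
  let ?h = "\<lambda>s. indicator {0<..<t} s *\<^sub>R (rl_kernel x s * rl_kernel y (t - s))"
  define C where "C = t powr (x + y - 2) * rGamma x * rGamma y"
  have scale: "?h (0 + t * s) = C * (indicator {0<..<1} s *\<^sub>R ?g s)" for s
  proof (cases "0 < s \<and> s < 1")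
    case True
    have "t - t * s = t * (1 - s)" by (simp add: algebra_simps)
    moreover have "t powr (x + y - 2) = t powr (x - 1) * t powr (y - 1)"
      by (simp add: powr_add[symmetric])
    ultimately show ?thesis
      using True assms by (simp add: rl_kernel_def C_def powr_mult indicator_def)
  next
    case False
    then show ?thesis using assms(3) by (auto simp: indicator_def zero_less_mult_iff)
  qed
  have "integrable lborel (\<lambda>s. C * (indicator {0<..<1} s *\<^sub>R ?g s))"
    using int01 unfolding set_integrable_def by (rule integrable_mult_right)
  then have "integrable lborel (\<lambda>s. ?h (0 + t * s))" by (simp only: scale)
  then show "set_integrable lborel {0<..<t} (\<lambda>s. rl_kernel x s * rl_kernel y (t - s))"
    unfolding set_integrable_def using assms(3) by (subst (asm) lborel_integrable_real_affine_iff) auto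
  have "(LINT s:{0<..<t}|lborel. rl_kernel x s * rl_kernel y (t - s)) = \<bar>t\<bar> *\<^sub>R (LINT s|lborel. ?h (0 + t * s))"
    unfolding set_lebesgue_integral_def using assms(3) by (intro lborel_integral_real_affine) auto
  also have "\<dots> = t * (C * Beta x y)"
    using assms(3) val01 by (simp only: scale integral_mult_right_zero set_lebesgue_integral_def) simp
  also have "t * C = t powr (x + y - 1) * rGamma x * rGamma y"
    using assms(3) by (simp add: C_def powr_diff power2_eq_square)
  then have "t * (C * Beta x y) = t powr (x + y - 1) * (rGamma x * Gamma x) * (rGamma y * Gamma y) * rGamma (x + y)"
    unfolding Beta_altdef by (simp only: mult.assoc[symmetric]) (simp only: mult_ac)
  also have "\<dots> = rl_kernel (x + y) t"
    using Gamma_real_pos[OF assms(1)] Gamma_real_pos[OF assms(2)]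
    by (simp add: rl_kernel_def rGamma_inverse_Gamma)
  finally show "(LINT s:{0<..<t}|lborel. rl_kernel x s * rl_kernel y (t - s)) = rl_kernel (x + y) t" .
qed

section \<open>Convolution and fractional integration\<close>

lemma fps_conv_radius_mult_pos:
  fixes a b :: "real fps"
  assumes "0 < fps_conv_radius a" "0 < fps_conv_radius b"
  shows "0 < fps_conv_radius (a * b)"
  using fps_conv_radius_mult[of a b] assms by (auto simp: less_le_trans min_def split: if_splits)

lemma fps_conv_radius_add_pos:
  fixes a b :: "real fps"
  assumes "0 < fps_conv_radius a" "0 < fps_conv_radius b"
  shows "0 < fps_conv_radius (a + b)"
  using fps_conv_radius_add[of a b] assms by (auto simp: less_le_trans min_def split: if_splits)

text \<open>
  The kernels form a convolution semigroup, so grouping the product of the two series by total degree (the Cauchy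
  product) and integrating each group gives the coefficients of \<open>a * b\<close>. Integration term by term
  is justified by the same computation with the absolute values of the coefficients, as the kernels of
  positive order are nonnegative.
\<close>

lemma rl_series_convolution:
  assumes \<alpha>: "0 < \<alpha>" and pos: "0 < \<beta>" "0 < \<gamma>"
    and rad: "0 < fps_conv_radius a" "0 < fps_conv_radius b" and t: "0 < t"
  shows "set_integrable lborel {0<..<t} (\<lambda>s. rl_series \<alpha> \<beta> a s * rl_series \<alpha> \<gamma> b (t - s))" (is ?int)
    and "(LINT s:{0<..<t}|lborel. rl_series \<alpha> \<beta> a s * rl_series \<alpha> \<gamma> b (t - s)) =
      rl_series \<alpha> (\<beta> + \<gamma>) (a * b) t" (is ?val)
proof -
  define A where "A k s = fps_nth a k * rl_kernel (real k * \<alpha> + \<beta>) s" for k s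
  define B where "B k s = fps_nth b k * rl_kernel (real k * \<alpha> + \<gamma>) s" for k s
  define D where "D n s = indicator {0<..<t} s *\<^sub>R (\<Sum>i\<le>n. A i s * B (n - i) (t - s))" for n s
  have x_pos: "0 < real k * \<alpha> + \<beta>" "0 < real k * \<alpha> + \<gamma>" for k
    using \<alpha> pos by (auto intro: add_nonneg_pos)
  have AB: "(\<lambda>s. indicator {0<..<t} s *\<^sub>R (A i s * B j (t - s))) = 
     (\<lambda>s. fps_nth a i * fps_nth b j * (indicator {0<..<t} s *\<^sub>R
        (rl_kernel (real i * \<alpha> + \<beta>) s * rl_kernel (real j * \<alpha> + \<gamma>) (t - s))))" for i j
    by (auto simp: A_def B_def)
  note conv = rl_kernel_convolution[OF x_pos(1) x_pos(2) t, unfolded set_integrable_def set_lebesgue_integral_def]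
  have AB_int: "integrable lborel (\<lambda>s. indicator {0<..<t} s *\<^sub>R (A i s * B j (t - s)))" for i j
    unfolding AB by (intro integrable_mult_right conv(1))
  have AB_val: "(LINT s|lborel. indicator {0<..<t} s *\<^sub>R (A i s * B j (t - s))) =
      fps_nth a i * fps_nth b j * rl_kernel (real (i + j) * \<alpha> + (\<beta> + \<gamma>)) t" for i j
    unfolding AB integral_mult_right_zero conv(2) by (simp add: algebra_simps)
  have AB_norm: "(LINT s|lborel. \<bar>indicator {0<..<t} s *\<^sub>R (A i s * B j (t - s))\<bar>) =
      \<bar>fps_nth a i\<bar> * \<bar>fps_nth b j\<bar> * rl_kernel (real (i + j) * \<alpha> + (\<beta> + \<gamma>)) t" for i j
  proof -
    have "(\<lambda>s. \<bar>indicator {0<..<t} s *\<^sub>R (A i s * B j (t - s))\<bar>) =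
      (\<lambda>s. \<bar>fps_nth a i\<bar> * \<bar>fps_nth b j\<bar> * (indicator {0<..<t} s *\<^sub>R
        (rl_kernel (real i * \<alpha> + \<beta>) s * rl_kernel (real j * \<alpha> + \<gamma>) (t - s))))"
      using x_pos by (auto simp: A_def B_def abs_mult rl_kernel_nonneg)
    then show ?thesis
      by (simp only: integral_mult_right_zero conv(2)) (simp add: algebra_simps)
  qed
  have D_alt: "D n = (\<lambda>s. \<Sum>i\<le>n. indicator {0<..<t} s *\<^sub>R (A i s * B (n - i) (t - s)))" for n
    by (auto simp: D_def sum_distrib_left)
  have D_int: "integrable lborel (D n)" for n
    unfolding D_alt by (intro Bochner_Integration.integrable_sum AB_int)
  have D_val: "(LINT s|lborel. D n s) = fps_nth (a * b) n * rl_kernel (real n * \<alpha> + (\<beta> + \<gamma>)) t" for n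
    unfolding D_alt
    by (subst Bochner_Integration.integral_sum[OF AB_int])
       (auto simp: AB_val fps_mult_nth sum_distrib_right atMost_atLeast0 simp del: real_scaleR_def intro!: sum.cong)
  have D_norm_sum: "summable (\<lambda>n. LINT s|lborel. norm (D n s))"
  proof (rule summable_comparison_test)
    define a' b' where "a' = Abs_fps (\<lambda>n. norm (fps_nth a n))" and "b' = Abs_fps (\<lambda>n. norm (fps_nth b n))"
    have "0 < fps_conv_radius (a' * b')"
      unfolding a'_def b'_def using rad by (intro fps_conv_radius_mult_pos) (simp_all only: fps_conv_radius_norm)
    then show "summable (\<lambda>n. \<bar>fps_nth (a' * b') n * rl_kernel (real n * \<alpha> + (\<beta> + \<gamma>)) t\<bar>)"
      using \<alpha> t by (intro rl_series_abs_summable)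
    have "(LINT s|lborel. norm (D n s)) \<le> \<bar>fps_nth (a' * b') n * rl_kernel (real n * \<alpha> + (\<beta> + \<gamma>)) t\<bar>" for n
    proof -
      have "(LINT s|lborel. norm (D n s)) \<le>
          (LINT s|lborel. (\<Sum>i\<le>n. \<bar>indicator {0<..<t} s *\<^sub>R (A i s * B (n - i) (t - s))\<bar>))"
        unfolding D_alt real_norm_def
        by (intro integral_mono integrable_abs Bochner_Integration.integrable_sum AB_int sum_abs)
      also have "\<dots> = fps_nth (a' * b') n * rl_kernel (real n * \<alpha> + (\<beta> + \<gamma>)) t"
        by (subst Bochner_Integration.integral_sum[OF integrable_abs[OF AB_int]])
           (auto simp: AB_norm a'_def b'_def fps_mult_nth sum_distrib_right atMost_atLeast0
             simp del: real_scaleR_def intro!: sum.cong)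
      finally show ?thesis by linarith
    qed
    then show "\<exists>N. \<forall>n\<ge>N. norm (LINT s|lborel. norm (D n s)) \<le>
        \<bar>fps_nth (a' * b') n * rl_kernel (real n * \<alpha> + (\<beta> + \<gamma>)) t\<bar>"
      by (intro exI[of _ 0]) (auto simp: integral_nonneg_AE)
  qed
  have D_sums: "(\<lambda>n. D n s) sums (indicator {0<..<t} s *\<^sub>R (rl_series \<alpha> \<beta> a s * rl_series \<alpha> \<gamma> b (t - s)))"
    and D_summable: "summable (\<lambda>n. norm (D n s))" for s
  proof -
    have "(\<lambda>n. D n s) sums (indicator {0<..<t} s *\<^sub>R (rl_series \<alpha> \<beta> a s * rl_series \<alpha> \<gamma> b (t - s))) \<and>
        summable (\<lambda>n. norm (D n s))"
    proof (cases "s \<in> {0<..<t}")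
      case True
      have sA: "summable (\<lambda>k. norm (A k s))" and sB: "summable (\<lambda>k. norm (B k (t - s)))"
        unfolding A_def B_def real_norm_def using True rad \<alpha>
        by (auto intro!: rl_series_abs_summable simp del: abs_mult)
      have "(\<lambda>n. \<Sum>i\<le>n. A i s * B (n - i) (t - s)) sums (rl_series \<alpha> \<beta> a s * rl_series \<alpha> \<gamma> b (t - s))"
        using Cauchy_product_sums[OF sA sB] by (simp add: A_def B_def rl_series_def)
      moreover have "summable (\<lambda>n. norm (\<Sum>i\<le>n. A i s * B (n - i) (t - s)))"
      proof (rule summable_comparison_test)
        show "summable (\<lambda>n. \<Sum>i\<le>n. norm (A i s) * norm (B (n - i) (t - s)))"
          using sA sB by (intro summable_Cauchy_product) simp_all
        show "\<exists>N. \<forall>n\<ge>N. norm (norm (\<Sum>i\<le>n. A i s * B (n - i) (t - s))) \<le>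
            (\<Sum>i\<le>n. norm (A i s) * norm (B (n - i) (t - s)))"
          by (auto simp flip: abs_mult)
      qed
      ultimately show ?thesis using True by (simp add: D_def)
    qed (simp add: D_def)
    then show "(\<lambda>n. D n s) sums (indicator {0<..<t} s *\<^sub>R (rl_series \<alpha> \<beta> a s * rl_series \<alpha> \<gamma> b (t - s)))"
      and "summable (\<lambda>n. norm (D n s))" by auto
  qed
  have D_suminf: "(\<lambda>s. \<Sum>n. D n s) =
      (\<lambda>s. indicator {0<..<t} s *\<^sub>R (rl_series \<alpha> \<beta> a s * rl_series \<alpha> \<gamma> b (t - s)))"
    using D_sums by (auto simp: sums_iff)
  have AE: "AE s in lborel. summable (\<lambda>n. norm (D n s))" using D_summable by simp
  show ?int
    using integrable_suminf[OF D_int AE D_norm_sum] by (simp add: set_integrable_def D_suminf)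
  show ?val
    using integral_suminf[OF D_int AE D_norm_sum]
    by (simp only: set_lebesgue_integral_def D_suminf D_val rl_series_def)
qed

text \<open>
  Convolution with the constant power series \<open>1\<close> is convolution with a single kernel; in this form it is the
  integral that occurs in the Caputo derivative.
\<close>

lemma rl_series_fractional_integral:
  assumes "0 < \<alpha>" "0 < \<beta>" "0 < \<gamma>" "0 < fps_conv_radius a" "0 < t"
  shows "set_integrable lborel {0<..<t} (\<lambda>s. (t - s) powr (\<gamma> - 1) * rl_series \<alpha> \<beta> a s)"
    and "1 / Gamma \<gamma> * (LINT s:{0<..<t}|lborel. (t - s) powr (\<gamma> - 1) * rl_series \<alpha> \<beta> a s) =
      rl_series \<alpha> (\<beta> + \<gamma>) a t"
proof -
  have eq: "(\<lambda>s. Gamma \<gamma> * (rl_series \<alpha> \<beta> a s * rl_series \<alpha> \<gamma> 1 (t - s))) =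
      (\<lambda>s. (t - s) powr (\<gamma> - 1) * rl_series \<alpha> \<beta> a s)"
    using Gamma_real_pos[OF assms(3)]
    by (simp add: rl_series_one rl_kernel_def rGamma_inverse_Gamma fun_eq_iff)
  have one: "0 < fps_conv_radius (1 :: real fps)" by simp
  note conv = rl_series_convolution[OF assms(1-4) one assms(5)]
  show "set_integrable lborel {0<..<t} (\<lambda>s. (t - s) powr (\<gamma> - 1) * rl_series \<alpha> \<beta> a s)"
    using conv(1) unfolding eq[symmetric] by (intro set_integrable_mult_right) simp
  show "1 / Gamma \<gamma> * (LINT s:{0<..<t}|lborel. (t - s) powr (\<gamma> - 1) * rl_series \<alpha> \<beta> a s) =
      rl_series \<alpha> (\<beta> + \<gamma>) a t"
    using conv(2) Gamma_real_pos[OF assms(3)] by (simp add: eq[symmetric] del: mult.assoc)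
qed

section \<open>Mittag-Leffler functions as images of rational power series\<close>

definition geom_fps :: "real \<Rightarrow> real fps" where
  "geom_fps x = Abs_fps (\<lambda>k. x ^ k)"

lemma geom_fps_mult: "geom_fps x * (1 - fps_const x * fps_X) = 1"
proof -
  have "fps_nth (geom_fps x - fps_const x * (geom_fps x * fps_X)) k = fps_nth 1 k" for k
    by (cases k) (simp_all add: geom_fps_def)
  then show ?thesis by (intro fps_ext) (simp add: algebra_simps)
qed

lemma fps_conv_radius_geom_pos: "0 < fps_conv_radius (geom_fps x)"
proof -
  have "ereal (norm (1 / (\<bar>x\<bar> + 1) / 2)) \<le> conv_radius (\<lambda>k. x ^ k)"
  proof (rule conv_radius_geI)
    have "summable (\<lambda>k. (x * (1 / (\<bar>x\<bar> + 1) / 2)) ^ k)"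
      by (rule summable_geometric) (simp add: abs_mult field_simps)
    then show "summable (\<lambda>k. x ^ k * (1 / (\<bar>x\<bar> + 1) / 2) ^ k)"
      by (simp only: power_mult_distrib)
  qed
  moreover have "0 < ereal (norm (1 / (\<bar>x\<bar> + 1) / 2))" by simp
  ultimately show ?thesis
    unfolding fps_conv_radius_def geom_fps_def by (simp del: ereal_less(2) add: less_le_trans)
qed

lemma mittag_leffler_eq_rl_series:
  assumes "0 < t"
  shows "mittag_leffler \<alpha> 1 (x * t powr \<alpha>) = rl_series \<alpha> 1 (geom_fps x) t"
proof -
  have "Gamma (real j + 1) * (x * t powr \<alpha>) ^ j / (fact j * Gamma (real j * \<alpha> + 1))
      = fps_nth (geom_fps x) j * rl_kernel (real j * \<alpha> + 1) t" for j
    unfolding rl_kernel_powser[OF assms] power_mult_distrib rGamma_inverse_Gamma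
    using Gamma_fact[of j, where 'a = real] assms
    by (simp add: geom_fps_def add.commute divide_inverse)
  then show ?thesis
    by (simp add: mittag_leffler_def mittag_leffler3_def rl_series_def)
qed

lemma mittag_leffler_0: "mittag_leffler \<alpha> 1 0 = 1"
proof -
  have "(\<lambda>j. Gamma (real j + 1) * 0 ^ j / (fact j * Gamma (real j * \<alpha> + 1))) sums 1"
    using sums_single[of 0 "\<lambda>j. 1::real"]
    by (rule sums_cong[THEN iffD1, rotated]) auto
  then show ?thesis by (simp add: mittag_leffler_def mittag_leffler3_def sums_iff)
qed

text \<open>
  The factor $\Gamma(k+2)/k! = k+1$ in the Mittag-Leffler series is the $k$-th coefficient of $(1-X)^{-2}$.
\<close>

lemma interarrival_density_eq_rl_series:
  assumes "0 < \<alpha>" "0 < t"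
  shows "interarrival_density lam \<alpha> t =
    rl_series \<alpha> (2 * \<alpha>) (fps_const (lam\<^sup>2) * (geom_fps (- lam))\<^sup>2) t"
proof -
  \<comment> \<open>The convolution square of a geometric sequence is the sequence multiplied by its number of terms.\<close>
  have sq: "fps_nth ((geom_fps (- lam))\<^sup>2) k = (real k + 1) * (- lam) ^ k" for k
    by (simp add: power2_eq_square fps_mult_nth geom_fps_def power_add[symmetric])
  have rad: "0 < fps_conv_radius ((geom_fps (- lam))\<^sup>2)"
    unfolding power2_eq_square by (intro fps_conv_radius_mult_pos fps_conv_radius_geom_pos)
  define c where "c = t powr (2 * \<alpha> - 1)"
  have c: "c \<noteq> 0" using assms by (simp add: c_def)
  have "inverse c * (fps_nth ((geom_fps (- lam))\<^sup>2) k * rl_kernel (real k * \<alpha> + 2 * \<alpha>) t) =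
      Gamma (real k + 2) * (- lam * t powr \<alpha>) ^ k / (fact k * Gamma (real k * \<alpha> + 2 * \<alpha>))" for k
  proof -
    have "Gamma (real k + 2) = (real k + 1) * fact k"
      using Gamma_fact[of "Suc k", where 'a = real] by (simp add: algebra_simps)
    then show ?thesis
      unfolding sq rl_kernel_powser[OF assms(2)] power_mult_distrib rGamma_inverse_Gamma
      using c by (simp add: divide_inverse c_def[symmetric])
  qed
  then have "(\<lambda>k. Gamma (real k + 2) * (- lam * t powr \<alpha>) ^ k / (fact k * Gamma (real k * \<alpha> + 2 * \<alpha>)))
      sums (inverse c * rl_series \<alpha> (2 * \<alpha>) ((geom_fps (- lam))\<^sup>2) t)"
    using sums_mult[OF rl_series_sums[OF assms(1) rad assms(2), of "2 * \<alpha>"], of "inverse c"] by simp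
  moreover have "Gamma (2::real) = 1"
    using Gamma_fact[of 1, where 'a = real] by simp
  ultimately have "mittag_leffler3 \<alpha> (2 * \<alpha>) 2 (- lam * t powr \<alpha>) =
      inverse c * rl_series \<alpha> (2 * \<alpha>) ((geom_fps (- lam))\<^sup>2) t"
    by (simp add: mittag_leffler3_def sums_iff)
  then show ?thesis
    using assms rad c by (simp add: interarrival_density_def rl_series_cmult c_def[symmetric])
qed

section \<open>Algebra of the generating power series\<close>

text \<open>
  The power series $n$ of the introduction. It is made the primary object, rather than $m = 1 + X^2 n$, because the
  Caputo derivatives see only $n$.
\<close>

definition mgf_tail_fps :: "real \<Rightarrow> real \<Rightarrow> real fps" where
  "mgf_tail_fps lam p = fps_const (lam\<^sup>2 * (p\<^sup>2 - 1)) * (geom_fps (- lam * (1 - p)) * geom_fps (- lam * (1 + p)))"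

definition mgf_fps :: "real \<Rightarrow> real \<Rightarrow> real fps" where
  "mgf_fps lam p = 1 + fps_X\<^sup>2 * mgf_tail_fps lam p"

lemma mgf_tail_fps_pos: "0 < fps_conv_radius (mgf_tail_fps lam p)"
  unfolding mgf_tail_fps_def
  by (intro fps_conv_radius_mult_pos fps_conv_radius_geom_pos) simp

lemma mgf_fps_pos: "0 < fps_conv_radius (mgf_fps lam p)"
  unfolding mgf_fps_def
  by (intro fps_conv_radius_add_pos fps_conv_radius_mult_pos mgf_tail_fps_pos) simp_all

text \<open>
  The denominators multiply to $(1+\lambda X)^2 - p^2\lambda^2X^2$. Keeping
  them on the left makes the differential equation and the renewal equation identities of polynomials in $X$ and $n$.
\<close>

lemma mgf_tail_fps_eq:
  "mgf_tail_fps lam p * (1 + fps_const (2 * lam) * fps_X + fps_const (lam\<^sup>2 * (1 - p\<^sup>2)) * fps_X\<^sup>2)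
    = fps_const (lam\<^sup>2 * (p\<^sup>2 - 1))"
proof -
  define x y where "x = - lam * (1 - p)" and "y = - lam * (1 + p)"
  have "(1 - fps_const x * fps_X) * (1 - fps_const y * fps_X) =
     1 - fps_const (x + y) * fps_X + fps_const (x * y) * fps_X\<^sup>2"
    by (simp add: algebra_simps power2_eq_square flip: fps_const_add fps_const_mult)
  also have "x + y = - (2 * lam)" by (simp add: x_def y_def algebra_simps)
  also have "x * y = lam\<^sup>2 * (1 - p\<^sup>2)" by (simp add: x_def y_def algebra_simps power2_eq_square)
  finally have D: "1 + fps_const (2 * lam) * fps_X + fps_const (lam\<^sup>2 * (1 - p\<^sup>2)) * fps_X\<^sup>2 =
      (1 - fps_const x * fps_X) * (1 - fps_const y * fps_X)"
    by (simp flip: fps_const_neg)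
  have "mgf_tail_fps lam p * ((1 - fps_const x * fps_X) * (1 - fps_const y * fps_X)) =
     fps_const (lam\<^sup>2 * (p\<^sup>2 - 1)) * ((geom_fps x * (1 - fps_const x * fps_X)) * (geom_fps y * (1 - fps_const y * fps_X)))"
    unfolding mgf_tail_fps_def x_def[symmetric] y_def[symmetric] by (simp only: mult_ac)
  then show ?thesis unfolding D geom_fps_mult by simp
qed

text \<open>
  The fractional differential equation on the level of power series: $n$ stands for the derivative of order
  $2\alpha$, $Xn$ for that of order $\alpha$.
\<close>

lemma mgf_fps_fde:
  "mgf_tail_fps lam p + fps_const (2 * lam) * (fps_X * mgf_tail_fps lam p) =
    fps_const (lam\<^sup>2 * (p\<^sup>2 - 1)) * mgf_fps lam p"
proof -
  define n where "n = mgf_tail_fps lam p"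
  define c where "c = lam\<^sup>2 * (p\<^sup>2 - 1)"
  have c': "lam\<^sup>2 * (1 - p\<^sup>2) = - c" by (simp add: c_def algebra_simps)
  have "n * (1 + fps_const (2 * lam) * fps_X - fps_const c * fps_X\<^sup>2) = fps_const c"
    using mgf_tail_fps_eq[of lam p] unfolding n_def[symmetric] c' c_def[symmetric]
    by (simp flip: fps_const_neg)
  then have "n + fps_const (2 * lam) * (fps_X * n) = fps_const c * (1 + fps_X\<^sup>2 * n)"
    by (simp add: algebra_simps)
  then show ?thesis by (simp add: mgf_fps_def n_def c_def)
qed

text \<open>
  The renewal equation $w(p^2 m - 1) = m - 1$ with a factor $X^2$ cancelled on both sides.
\<close>

lemma mgf_fps_renewal:
  "fps_const (lam\<^sup>2) * (geom_fps (- lam))\<^sup>2 * (fps_const (p\<^sup>2) * mgf_fps lam p - 1) = mgf_tail_fps lam p"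
proof -
  define n where "n = mgf_tail_fps lam p"
  define g where "g = geom_fps (- lam)"
  define L where "L = fps_const lam"
  define Q where "Q = fps_const (p\<^sup>2)"
  have cs: "fps_const (lam\<^sup>2 * (1 - p\<^sup>2)) = L\<^sup>2 * (1 - Q)" "fps_const (lam\<^sup>2 * (p\<^sup>2 - 1)) = L\<^sup>2 * (Q - 1)"
     "fps_const (lam\<^sup>2) = L\<^sup>2" "fps_const (2 * lam) = 2 * L"
    by (simp_all add: L_def Q_def numeral_fps_const flip: fps_const_mult fps_const_sub fps_const_power)
  have n: "n * (1 + 2 * L * fps_X + L\<^sup>2 * (1 - Q) * fps_X\<^sup>2) = L\<^sup>2 * (Q - 1)"
    using mgf_tail_fps_eq[of lam p] unfolding cs n_def .
  have g: "g * (1 + L * fps_X) = 1"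
    using geom_fps_mult[of "- lam"] by (simp add: g_def L_def flip: fps_const_neg)
  have "L\<^sup>2 * g\<^sup>2 * (Q * (1 + fps_X\<^sup>2 * n) - 1) = g\<^sup>2 * (L\<^sup>2 * (Q - 1) + L\<^sup>2 * Q * fps_X\<^sup>2 * n)"
    by (simp add: algebra_simps)
  also have "L\<^sup>2 * (Q - 1) + L\<^sup>2 * Q * fps_X\<^sup>2 * n = n * (1 + L * fps_X)\<^sup>2"
    unfolding n[symmetric] by (simp add: algebra_simps power2_eq_square)
  also have "g\<^sup>2 * (n * (1 + L * fps_X)\<^sup>2) = (g * (1 + L * fps_X))\<^sup>2 * n"
    by (simp add: power_mult_distrib mult_ac)
  also have "\<dots> = n" by (simp add: g)
  finally show ?thesis by (simp add: cs n_def g_def Q_def[symmetric] mgf_fps_def)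
qed

lemma mgf_fps_partial_fractions:
  assumes "p \<noteq> 0"
  shows "mgf_fps lam p = fps_const ((p + 1) / (2 * p)) * geom_fps (- lam * (1 - p)) +
     fps_const ((p - 1) / (2 * p)) * geom_fps (- lam * (1 + p))"
proof -
  define x y where "x = - lam * (1 - p)" and "y = - lam * (1 + p)"
  define A B where "A = (p + 1) / (2 * p)" and "B = (p - 1) / (2 * p)"
  have AB1: "A + B = 1" using assms by (simp add: A_def B_def field_simps)
  have AB2: "A * y + B * x = x + y"
    using assms by (simp add: A_def B_def x_def y_def field_simps)
  have c: "lam\<^sup>2 * (p\<^sup>2 - 1) = - (x * y)" by (simp add: x_def y_def algebra_simps power2_eq_square)
  define X Y where "X = fps_const x * fps_X" and "Y = fps_const y * fps_X"
  have gX: "geom_fps x * (1 - X) = 1" and gY: "geom_fps y * (1 - Y) = 1"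
    by (simp_all add: X_def Y_def geom_fps_mult)
  \<comment> \<open>In terms of $X = xT$ and $Y = yT$, with $T$ the formal variable, $m = (1-X-Y)/((1-X)(1-Y))$.\<close>
  have "mgf_fps lam p = 1 - X * Y * (geom_fps x * geom_fps y)"
    unfolding mgf_fps_def mgf_tail_fps_def c x_def[symmetric] y_def[symmetric] X_def Y_def
    by (simp add: power2_eq_square mult_ac flip: fps_const_neg fps_const_mult)
  also have "1 = (geom_fps x * (1 - X)) * (geom_fps y * (1 - Y))" by (simp add: gX gY)
  also have "(geom_fps x * (1 - X)) * (geom_fps y * (1 - Y)) - X * Y * (geom_fps x * geom_fps y) =
      (1 - (X + Y)) * (geom_fps x * geom_fps y)"
    by (simp add: algebra_simps)
  also have "X + Y = fps_const A * Y + fps_const B * X"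
    unfolding X_def Y_def by (simp add: AB2[symmetric] algebra_simps flip: fps_const_add fps_const_mult)
  also have "1 = fps_const A + fps_const B"
    by (simp add: AB1)
  also have "(fps_const A + fps_const B - (fps_const A * Y + fps_const B * X)) * (geom_fps x * geom_fps y) =
      fps_const A * geom_fps x * (geom_fps y * (1 - Y)) + fps_const B * geom_fps y * (geom_fps x * (1 - X))"
    by (simp only: algebra_simps mult_1_left)
  finally show ?thesis unfolding gX gY by (simp add: A_def B_def x_def y_def)
qed

section \<open>Renewal counting processes\<close>

text \<open>
  The summand at $n$ is nonzero only if $S_n \le t < S_{n+1}$, that is, if $n$ is the number of epochs up to $t$; the sum
  sees this index precisely when it is below $m$.
\<close>

lemma sum_renewal_levels:
  fixes S :: "nat \<Rightarrow> real" and q t Z :: real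
  assumes "incseq S" "S 0 \<le> t"
    and Z_def: "Z = (\<Sum>n<m. q ^ n * (indicator {..t} (S n) - indicator {..t} (S (Suc n))))"
  shows "t < S m \<Longrightarrow> Z = q ^ card {n. 1 \<le> n \<and> S n \<le> t}"
    and "S m \<le> t \<Longrightarrow> Z = 0"
proof -
  assume m: "t < S m"
  define l where "l = (LEAST n. t < S n)"
  have l: "t < S l" and l_le: "\<And>n. t < S n \<Longrightarrow> l \<le> n"
    unfolding l_def using m by (auto intro: LeastI Least_le)
  have "l \<noteq> 0" using l assms(2) by (cases "l = 0") auto
  then obtain k where k: "l = Suc k" by (cases l) auto
  have iff: "S n \<le> t \<longleftrightarrow> n \<le> k" for n
    using l_le[of n] l incseqD[OF assms(1), of l n] k by force
  have "k < m" using l_le[OF m] k by simp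
  have "Z = (\<Sum>n<m. if n = k then q ^ n else 0)"
    unfolding Z_def by (intro sum.cong) (auto simp: indicator_def iff)
  also have "\<dots> = q ^ k" using \<open>k < m\<close> by simp
  also have "{n. 1 \<le> n \<and> S n \<le> t} = {1..k}" by (auto simp: iff)
  then have "q ^ k = q ^ card {n. 1 \<le> n \<and> S n \<le> t}" by simp
  finally show "Z = q ^ card {n. 1 \<le> n \<and> S n \<le> t}" .
next
  assume m: "S m \<le> t"
  have "S n \<le> t" if "n \<le> m" for n
    using m incseqD[OF assms(1) that] by simp
  then show "Z = 0" unfolding Z_def by (auto intro!: sum.neutral)
qed

context prob_space
begin

lemma expectation_indep_add:
  fixes X Y :: "'a \<Rightarrow> real" and h k :: "real \<Rightarrow> real"
  assumes ind: "indep_var borel X borel Y" and [measurable]: "h \<in> borel_measurable borel"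
    and int: "integrable M (\<lambda>\<omega>. h (Y \<omega> + X \<omega>))"
    and k: "\<And>s. expectation (\<lambda>\<omega>. h (s + X \<omega>)) = k s"
  shows "expectation (\<lambda>\<omega>. h (Y \<omega> + X \<omega>)) = expectation (\<lambda>\<omega>. k (Y \<omega>))"
proof -
  have [measurable]: "X \<in> borel_measurable M" "Y \<in> borel_measurable M"
    and eq: "distr M borel X \<Otimes>\<^sub>M distr M borel Y = distr M (borel \<Otimes>\<^sub>M borel) (\<lambda>\<omega>. (X \<omega>, Y \<omega>))"
    using ind unfolding indep_var_distribution_eq by auto
  interpret PX: prob_space "distr M borel X" by (rule prob_space_distr) simp
  interpret PY: prob_space "distr M borel Y" by (rule prob_space_distr) simp
  interpret PP: pair_sigma_finite "distr M borel X" "distr M borel Y" ..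
  have int2: "integrable (distr M borel X \<Otimes>\<^sub>M distr M borel Y) (\<lambda>(x, y). h (y + x))"
    unfolding eq using int by (subst integrable_distr_eq) (simp_all add: split_beta)
  have inner: "(\<integral>x. h (y + x) \<partial>distr M borel X) = k y" for y
    by (subst integral_distr) (simp_all add: k)
  have "(\<lambda>y. \<integral>x. h (y + x) \<partial>distr M borel X) \<in> borel_measurable borel"
    by measurable
  then have k_meas: "k \<in> borel_measurable borel" by (simp only: inner)
  have "expectation (\<lambda>\<omega>. h (Y \<omega> + X \<omega>)) = (\<integral>z. (\<lambda>(x, y). h (y + x)) z \<partial>(distr M borel X \<Otimes>\<^sub>M distr M borel Y))"
    unfolding eq by (subst integral_distr) (simp_all add: split_beta)
  also have "\<dots> = (\<integral>y. (\<integral>x. h (y + x) \<partial>distr M borel X) \<partial>distr M borel Y)"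
    using PP.integral_snd[OF int2] by simp
  also have "\<dots> = expectation (\<lambda>\<omega>. k (Y \<omega>))"
    unfolding inner using k_meas by (subst integral_distr) simp_all
  finally show ?thesis .
qed

text \<open>
  A bounded solution $G$ of the renewal equation is the generating function of the counting process. Extending $G$ and
  the constant $1$ by zero to negative arguments removes the case distinction of whether the next arrival is before $t$, so
  that the renewal equation can be substituted into itself with $x = t - S_n$. The error after $m$ steps is controlled by
  $\Pr(S_m \le t)$, and the paths on which the epochs accumulate before $t$ belong to this event for every $m$.
\<close>

lemma expectation_power_renewal_count:
  fixes T :: "nat \<Rightarrow> 'a \<Rightarrow> real" and G :: "real \<Rightarrow> real" and q r t K :: real
  assumes ind: "indep_vars (\<lambda>_. borel) T UNIV"
    and pos: "\<And>i. AE \<omega> in M. 0 < T i \<omega>"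
    and laplace: "\<And>i. expectation (\<lambda>\<omega>. exp (- T i \<omega>)) = r" and "r < 1"
    and q: "0 \<le> q" "q \<le> 1" and t: "0 \<le> t"
    and G_meas [measurable]: "G \<in> borel_measurable borel"
    and G_neg: "\<And>x. x < 0 \<Longrightarrow> G x = 0"
    and G_bound: "\<And>x. x \<le> t \<Longrightarrow> \<bar>G x\<bar> \<le> K"
    and renewal: "\<And>i x. expectation (\<lambda>\<omega>. q * G (x - T i \<omega>) - indicator {0..} (x - T i \<omega>)) =
       G x - indicator {0..} x"
  shows "expectation (\<lambda>\<omega>. q ^ card {n. 1 \<le> n \<and> (\<Sum>i<n. T i \<omega>) \<le> t}) = G t"
proof -
  define S where "S n \<omega> = (\<Sum>i<n. T i \<omega>)" for n \<omega>
  have T_meas [measurable]: "T i \<in> borel_measurable M" for i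
    using ind by (simp add: indep_vars_def)
  have S_meas [measurable]: "S n \<in> borel_measurable M" for n
    unfolding S_def by measurable
  have S_Suc: "S (Suc n) \<omega> = S n \<omega> + T n \<omega>" for n \<omega>
    by (simp add: S_def)
  have AE_T: "AE \<omega> in M. \<forall>i. 0 < T i \<omega>"
    using pos by (simp add: AE_all_countable)
  have AE_S: "AE \<omega> in M. incseq (\<lambda>n. S n \<omega>)"
    using AE_T by eventually_elim (auto intro!: incseq_SucI less_imp_le simp: S_Suc)
  have AE_S_nonneg: "AE \<omega> in M. 0 \<le> S n \<omega>" for n
    using AE_T by eventually_elim (auto simp: S_def less_imp_le intro!: sum_nonneg)
  have indep_S: "indep_var borel (T n) borel (S n)" for n
    unfolding S_def by (intro indep_vars_sum indep_vars_subset[OF ind]) auto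
  define g p where "g n = expectation (\<lambda>\<omega>. G (t - S n \<omega>))"
    and "p n = expectation (\<lambda>\<omega>. indicator {0..} (t - S n \<omega>) :: real)" for n
  have K: "0 \<le> K" using G_bound[of t] by linarith
  have G_le: "AE \<omega> in M. \<bar>G (t - S n \<omega>)\<bar> \<le> K * indicator {0..} (t - S n \<omega>)" for n
    using AE_S_nonneg[of n] by eventually_elim (auto simp: indicator_def G_bound G_neg)
  have G_int: "integrable M (\<lambda>\<omega>. G (t - S n \<omega>))" for n
    using AE_S_nonneg[of n] by (intro integrable_const_bound[of _ K]) (auto intro!: G_bound elim!: eventually_mono)
  have I_int: "integrable M (\<lambda>\<omega>. indicator {0..} (t - S n \<omega>) :: real)" for n
    by (intro integrable_const_bound[of _ 1]) (auto simp: indicator_def)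
  have e_int: "integrable M (\<lambda>\<omega>. exp (- S n \<omega>))" for n
    using AE_S_nonneg[of n] by (intro integrable_const_bound[of _ 1]) (auto elim!: eventually_mono)
  have e_val: "expectation (\<lambda>\<omega>. exp (- S n \<omega>)) = r ^ n" for n
  proof (induction n)
    case 0
    show ?case by (simp add: S_def prob_space)
  next
    case (Suc n)
    have "expectation (\<lambda>\<omega>. exp (- (S n \<omega> + T n \<omega>))) = expectation (\<lambda>\<omega>. r * exp (- S n \<omega>))"
    proof (rule expectation_indep_add[OF indep_S, where h = "\<lambda>s. exp (- s)" and k = "\<lambda>s. r * exp (- s)"])
      show "integrable M (\<lambda>\<omega>. exp (- (S n \<omega> + T n \<omega>)))" using e_int[of "Suc n"] by (simp add: S_Suc)
      show "expectation (\<lambda>\<omega>. exp (- (s + T n \<omega>))) = r * exp (- s)" for s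
      proof -
        have "(\<lambda>\<omega>. exp (- (s + T n \<omega>))) = (\<lambda>\<omega>. exp (- s) * exp (- T n \<omega>))"
          by (simp add: exp_add[symmetric])
        then show ?thesis using laplace[of n] by (simp add: mult.commute)
      qed
    qed simp
    then show ?case using Suc by (simp add: S_Suc)
  qed
  have p_nonneg: "0 \<le> p n" for n unfolding p_def by (intro integral_nonneg_AE) simp
  \<comment> \<open>Chernoff bound: the indicator of $S_n \<le> t$ is at most $e^{t - S_n}$.\<close>
  have p_le: "p n \<le> exp t * r ^ n" for n
  proof -
    have "p n \<le> expectation (\<lambda>\<omega>. exp t * exp (- S n \<omega>))"
      unfolding p_def by (intro integral_mono I_int integrable_mult_right e_int)
        (auto simp: indicator_def simp flip: exp_add)
    then show ?thesis by (simp add: e_val)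
  qed
  have "0 \<le> r" using laplace[of 0] by (auto intro!: integral_nonneg_AE)
  then have "(\<lambda>n. exp t * r ^ n) \<longlonglongrightarrow> exp t * 0"
    using \<open>r < 1\<close> by (intro tendsto_intros LIMSEQ_realpow_zero)
  then have p_lim: "p \<longlonglongrightarrow> 0"
    using p_nonneg p_le by (intro tendsto_sandwich[of "\<lambda>_. 0" p _ "\<lambda>n. exp t * r ^ n"]) auto
  \<comment> \<open>One renewal: condition on $S_n$ and use the renewal equation at $x = t - S_n$.\<close>
  have step: "g n - p n = q * g (Suc n) - p (Suc n)" for n
  proof -
    have "expectation (\<lambda>\<omega>. q * G (t - (S n \<omega> + T n \<omega>)) - indicator {0..} (t - (S n \<omega> + T n \<omega>))) =
       expectation (\<lambda>\<omega>. G (t - S n \<omega>) - indicator {0..} (t - S n \<omega>))"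
    proof (rule expectation_indep_add[OF indep_S, where h = "\<lambda>s. q * G (t - s) - indicator {0..} (t - s)"
          and k = "\<lambda>s. G (t - s) - indicator {0..} (t - s)"])
      show "integrable M (\<lambda>\<omega>. q * G (t - (S n \<omega> + T n \<omega>)) - indicator {0..} (t - (S n \<omega> + T n \<omega>)))"
        using G_int[of "Suc n"] I_int[of "Suc n"] by (simp add: S_Suc)
      show "expectation (\<lambda>\<omega>. q * G (t - (s + T n \<omega>)) - indicator {0..} (t - (s + T n \<omega>))) =
          G (t - s) - indicator {0..} (t - s)" for s
        using renewal[of "t - s" n] by (simp add: diff_diff_eq)
    qed measurable
    then show ?thesis
      using G_int I_int by (simp add: g_def p_def flip: S_Suc)
  qed
  have telescope: "(\<Sum>n<m. q ^ n * (p n - p (Suc n))) = g 0 - q ^ m * g m" for m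
  proof (induction m)
    case (Suc m)
    have "q ^ m * (p m - p (Suc m)) = q ^ m * (g m - q * g (Suc m))"
      using step[of m] by (intro arg_cong[of _ _ "\<lambda>x. q ^ m * x"]) linarith
    then show ?case using Suc by (simp add: algebra_simps)
  qed simp
  have g0: "g 0 = G t" by (simp add: g_def S_def prob_space)
  have g_le: "\<bar>q ^ m * g m\<bar> \<le> K * p m" for m
  proof -
    have "\<bar>g m\<bar> \<le> expectation (\<lambda>\<omega>. \<bar>G (t - S m \<omega>)\<bar>)"
      unfolding g_def by (rule integral_abs_bound)
    also have "\<dots> \<le> expectation (\<lambda>\<omega>. K * indicator {0..} (t - S m \<omega>))"
      by (intro integral_mono_AE integrable_abs G_int integrable_mult_right I_int G_le)
    finally have "\<bar>g m\<bar> \<le> K * p m" by (simp add: p_def)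
    moreover have "\<bar>q ^ m * g m\<bar> \<le> \<bar>g m\<bar>"
      using q by (simp add: abs_mult power_le_one mult_left_le_one_le)
    ultimately show ?thesis by linarith
  qed
  define c where "c \<omega> = card {n. 1 \<le> n \<and> S n \<omega> \<le> t}" for \<omega>
  have [measurable]: "c \<in> measurable M (count_space UNIV)"
    unfolding c_def by measurable
  have c_int: "integrable M (\<lambda>\<omega>. q ^ c \<omega>)"
    using q by (intro integrable_const_bound[of _ 1]) (auto simp: power_le_one)
  define Z where "Z m \<omega> = (\<Sum>n<m. q ^ n * (indicator {0..} (t - S n \<omega>) - indicator {0..} (t - S (Suc n) \<omega>)))" for m \<omega>
  have Z_int: "integrable M (Z m)" for m
    unfolding Z_def by (intro Bochner_Integration.integrable_sum integrable_mult_right Bochner_Integration.integrable_diff I_int)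
  have Z_val: "expectation (Z m) = G t - q ^ m * g m" for m
  proof -
    have "expectation (Z m) = (\<Sum>n<m. q ^ n * (p n - p (Suc n)))"
      unfolding Z_def p_def using I_int
      by (subst Bochner_Integration.integral_sum) (simp_all add: Bochner_Integration.integral_diff)
    then show ?thesis by (simp add: telescope g0)
  qed
  \<comment> \<open>If $S_m > t$ the partial sum is already exact; otherwise it vanishes and the power lies in $[0,1]$.\<close>
  have Z_close: "AE \<omega> in M. \<bar>q ^ c \<omega> - Z m \<omega>\<bar> \<le> indicator {0..} (t - S m \<omega>)" for m
    using AE_S
  proof eventually_elim
    case (elim \<omega>)
    have Z: "Z m \<omega> = (\<Sum>n<m. q ^ n * (indicator {..t} (S n \<omega>) - indicator {..t} (S (Suc n) \<omega>)))"
      by (simp add: Z_def indicator_def)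
    have S0: "S 0 \<omega> \<le> t" using t by (simp add: S_def)
    note lev = sum_renewal_levels[OF elim S0 Z, folded c_def]
    show ?case
      using lev q by (cases "S m \<omega> \<le> t") (auto simp: indicator_def power_le_one)
  qed
  have "\<bar>expectation (\<lambda>\<omega>. q ^ c \<omega>) - G t\<bar> \<le> (1 + K) * p m" for m
  proof -
    have "\<bar>expectation (\<lambda>\<omega>. q ^ c \<omega>) - expectation (Z m)\<bar> = \<bar>expectation (\<lambda>\<omega>. q ^ c \<omega> - Z m \<omega>)\<bar>"
      using c_int Z_int by simp
    also have "\<dots> \<le> expectation (\<lambda>\<omega>. \<bar>q ^ c \<omega> - Z m \<omega>\<bar>)" by (rule integral_abs_bound)
    also have "\<dots> \<le> p m"
      unfolding p_def using c_int Z_int by (intro integral_mono_AE integrable_abs I_int Z_close) auto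
    finally show ?thesis
      using g_le[of m] unfolding Z_val by (simp add: algebra_simps) 
  qed
  moreover have "(\<lambda>m. (1 + K) * p m) \<longlonglongrightarrow> (1 + K) * 0"
    by (intro tendsto_intros p_lim)
  ultimately have "\<bar>expectation (\<lambda>\<omega>. q ^ c \<omega>) - G t\<bar> \<le> 0"
    by (intro LIMSEQ_le_const[where X = "\<lambda>m. (1 + K) * p m"]) auto
  then show ?thesis by (simp add: c_def S_def)
qed

end

section \<open>The renewal equation of the moment generating function\<close>

lemma borel_measurable_rl_series [measurable]: "rl_series \<alpha> \<beta> a \<in> borel_measurable borel"
  unfolding rl_series_def[abs_def] rl_kernel_def by measurable

lemma borel_measurable_interarrival_density [measurable]:
  "interarrival_density lam \<alpha> \<in> borel_measurable borel"
  unfolding interarrival_density_def[abs_def] mittag_leffler3_def by measurable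

text \<open>
  The density may be negative on a null set, where its image in the extended nonnegative reals is $0$; replacing it by its
  positive part changes neither the law nor the integral.
\<close>

lemma (in prob_space) expectation_has_real_density:
  assumes dens: "has_real_density M X f" and [measurable]: "f \<in> borel_measurable borel" "g \<in> borel_measurable borel"
  shows "expectation (\<lambda>\<omega>. g (X \<omega>)) = (LINT x|lborel. f x * g x)"
proof -
  have "(\<lambda>x. ennreal (max 0 (f x))) = (\<lambda>x. ennreal (f x))"
    by (auto simp: max_def ennreal_neg)
  then have "distributed M lborel X (\<lambda>x. ennreal (max 0 (f x)))" and nonneg: "AE x in lborel. 0 \<le> f x"
    using dens by (simp_all add: has_real_density_def)
  then have "expectation (\<lambda>\<omega>. g (X \<omega>)) = (LINT x|lborel. max 0 (f x) * g x)"
    by (subst distributed_integral) auto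
  also have "\<dots> = (LINT x|lborel. f x * g x)"
    using nonneg by (intro integral_cong_AE) (auto elim!: eventually_mono)
  finally show ?thesis .
qed

text \<open>
  The value at $0$ is set by hand, since the leading term $t^0$ of the series is encoded as \<open>0 powr 0 = 0\<close> there. The
  extension by zero to negative arguments is what the renewal equation below relies on.
\<close>

definition causal_mgf :: "real \<Rightarrow> real \<Rightarrow> real \<Rightarrow> real \<Rightarrow> real" where
  "causal_mgf lam \<alpha> p x = (if 0 < x then rl_series \<alpha> 1 (mgf_fps lam p) x else if x = 0 then 1 else 0)"

lemma borel_measurable_causal_mgf [measurable]: "causal_mgf lam \<alpha> p \<in> borel_measurable borel"
  unfolding causal_mgf_def[abs_def] by measurable

lemma causal_mgf_bounded:
  assumes "0 < \<alpha>"
  obtains K where "\<And>x. x \<le> t \<Longrightarrow> \<bar>causal_mgf lam \<alpha> p x\<bar> \<le> K"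
proof
  fix x assume x: "x \<le> t"
  show "\<bar>causal_mgf lam \<alpha> p x\<bar> \<le> 1 + \<bar>\<Sum>k. \<bar>fps_nth (mgf_fps lam p) k * rl_kernel (real k * \<alpha> + 1) t\<bar>\<bar>"
  proof (cases "0 < x")
    case True
    then have "\<bar>rl_series \<alpha> 1 (mgf_fps lam p) x\<bar> \<le>
        (x / t) powr (1 - 1) * (\<Sum>k. \<bar>fps_nth (mgf_fps lam p) k * rl_kernel (real k * \<alpha> + 1) t\<bar>)"
      using assms x by (intro rl_series_bound mgf_fps_pos) auto
    then show ?thesis using True x by (simp add: causal_mgf_def)
  qed (simp add: causal_mgf_def)
qed

text \<open>
  For positive $x$ the integrand lives on $(0,x)$, up to the null set $\{x\}$, and both factors are series of kernels,
  so the convolution theorem reduces the equation to \<open>mgf_fps_renewal\<close>. For other $x$ the integrand is zero because the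
  density lives on the positive half-line.
\<close>

lemma causal_mgf_renewal_equation:
  assumes "0 < \<alpha>"
  shows "(LINT s|lborel. interarrival_density lam \<alpha> s *
      (p\<^sup>2 * causal_mgf lam \<alpha> p (x - s) - indicator {0..} (x - s))) = causal_mgf lam \<alpha> p x - indicator {0..} x"
proof (cases "0 < x")
  case False
  have zero: "interarrival_density lam \<alpha> s * (p\<^sup>2 * causal_mgf lam \<alpha> p (x - s) - indicator {0..} (x - s)) = 0" for s
    using False by (auto simp: interarrival_density_def causal_mgf_def indicator_def)
  show ?thesis
    using False by (simp only: zero) (simp add: causal_mgf_def indicator_def)
next
  case True
  define c where "c = fps_const (lam\<^sup>2) * (geom_fps (- lam))\<^sup>2"
  define m where "m = mgf_fps lam p"
  define d where "d = fps_const (p\<^sup>2) * m + fps_const (-1) * 1"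
  have rad: "0 < fps_conv_radius c" "0 < fps_conv_radius d"
    unfolding c_def d_def m_def power2_eq_square[of "geom_fps _"]
    by (auto intro!: fps_conv_radius_mult_pos fps_conv_radius_add_pos fps_conv_radius_geom_pos mgf_fps_pos)
  have rads: "0 < fps_conv_radius (fps_const (p\<^sup>2) * m)" "0 < fps_conv_radius (fps_const (-1 :: real) * 1)"
    unfolding m_def by (auto intro!: fps_conv_radius_mult_pos mgf_fps_pos)
  have d_val: "rl_series \<alpha> 1 d y = p\<^sup>2 * causal_mgf lam \<alpha> p y - 1" if "0 < y" for y
  proof -
    have "rl_series \<alpha> 1 d y = p\<^sup>2 * rl_series \<alpha> 1 m y + (- 1) * rl_series \<alpha> 1 1 y"
      unfolding d_def rl_series_add[OF assms rads that]
      using assms that by (intro arg_cong2[of _ _ _ _ "(+)"] rl_series_cmult) (simp_all add: m_def mgf_fps_pos)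
    then show ?thesis
      using that by (simp add: causal_mgf_def m_def rl_series_one rl_kernel_def rGamma_inverse_Gamma)
  qed
  have "(LINT s|lborel. interarrival_density lam \<alpha> s *
      (p\<^sup>2 * causal_mgf lam \<alpha> p (x - s) - indicator {0..} (x - s))) =
    (LINT s:{0<..<x}|lborel. rl_series \<alpha> (2 * \<alpha>) c s * rl_series \<alpha> 1 d (x - s))"
    unfolding set_lebesgue_integral_def
  proof (rule integral_discrete_difference[of "{x}"])
    fix s assume "s \<notin> {x}"
    then consider "s \<le> 0" | "0 < s" "s < x" | "x < s" by force
    then show "interarrival_density lam \<alpha> s * (p\<^sup>2 * causal_mgf lam \<alpha> p (x - s) - indicator {0..} (x - s)) =
        indicator {0<..<x} s *\<^sub>R (rl_series \<alpha> (2 * \<alpha>) c s * rl_series \<alpha> 1 d (x - s))"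
    proof cases
      case 1
      then show ?thesis by (simp add: interarrival_density_def)
    next
      case 2
      then show ?thesis
        using assms by (simp add: d_val interarrival_density_eq_rl_series c_def)
    next
      case 3
      then show ?thesis by (simp add: causal_mgf_def)
    qed
  qed auto
  also have "\<dots> = rl_series \<alpha> (2 * \<alpha> + 1) (c * d) x"
    using assms rad True by (intro rl_series_convolution) auto
  also have "c * d = mgf_tail_fps lam p"
    using mgf_fps_renewal[of lam p] by (simp add: c_def d_def m_def flip: fps_const_neg)
  also have "rl_series \<alpha> (2 * \<alpha> + 1) (mgf_tail_fps lam p) x = causal_mgf lam \<alpha> p x - 1"
  proof -
    have "rl_series \<alpha> 1 m x = rl_series \<alpha> 1 1 x + rl_series \<alpha> 1 (fps_X\<^sup>2 * mgf_tail_fps lam p) x"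
      unfolding m_def mgf_fps_def using assms True
      by (intro rl_series_add fps_conv_radius_mult_pos mgf_tail_fps_pos) auto
    then show ?thesis
      using assms True by (simp add: causal_mgf_def m_def rl_series_X2_mult mgf_tail_fps_pos rl_series_one
        rl_kernel_def rGamma_inverse_Gamma add.commute)
  qed
  finally show ?thesis using True by (simp add: indicator_def)
qed

text \<open>
  The interarrival times are almost surely positive because their density vanishes on the nonpositive half-line. Hence
  their common Laplace transform at $1$ is strictly less than $1$, which is the last hypothesis of
  \<open>expectation_power_renewal_count\<close>.
\<close>

lemma moment_gen_eq_causal_mgf:
  assumes "0 < \<alpha>" and ren: "renewal_process M (interarrival_density lam \<alpha>) N"
    and "0 \<le> u" "0 \<le> t"
  shows "moment_gen M N u t = causal_mgf lam \<alpha> (sqrt (exp (- u))) t"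
proof -
  interpret prob_space M using ren by (simp add: renewal_process_def)
  let ?f = "interarrival_density lam \<alpha>"
  from ren obtain T :: "nat \<Rightarrow> _" where ind: "indep_vars (\<lambda>_. borel) T UNIV" and dens: "\<And>i. has_real_density M (T i) ?f"
    and "\<forall>t\<ge>0. \<forall>\<omega>\<in>space M. N t \<omega> = card {n. 1 \<le> n \<and> (\<Sum>i<n. T i \<omega>) \<le> t}"
    unfolding renewal_process_def by blast
  then have N: "\<And>\<omega>. \<omega> \<in> space M \<Longrightarrow> N t \<omega> = card {n. 1 \<le> n \<and> (\<Sum>i<n. T i \<omega>) \<le> t}"
    using \<open>0 \<le> t\<close> by blast
  note [measurable] = indep_vars_def[THEN iffD1, OF ind, THEN conjunct1, rule_format, simplified]
  note ex = expectation_has_real_density[OF dens borel_measurable_interarrival_density]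
  have T_pos: "AE \<omega> in M. 0 < T i \<omega>" for i
  proof -
    have "expectation (\<lambda>\<omega>. indicator {..0} (T i \<omega>) :: real) = (LINT x|lborel. ?f x * indicator {..0} x)"
      by (rule ex) simp
    also have "(\<lambda>x. ?f x * indicator {..0} x) = (\<lambda>x. 0)"
      by (auto simp: interarrival_density_def indicator_def)
    finally have zero: "expectation (\<lambda>\<omega>. indicator {..0} (T i \<omega>) :: real) = 0" by simp
    have "AE \<omega> in M. (indicator {..0} (T i \<omega>) :: real) = 0"
      by (rule integral_nonneg_eq_0_iff_AE[THEN iffD1, OF _ _ zero])
        (auto intro!: integrable_const_bound[of _ 1] simp: indicator_def)
    then show ?thesis by eventually_elim (auto simp: indicator_def split: if_splits)
  qed
  define r where "r = (LINT x|lborel. ?f x * exp (- x))"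
  have r: "expectation (\<lambda>\<omega>. exp (- T i \<omega>)) = r" for i
    unfolding r_def by (rule ex) simp
  have e_int: "integrable M (\<lambda>\<omega>. exp (- T 0 \<omega>))"
    using T_pos[of 0] by (intro integrable_const_bound[of _ 1]) (auto elim!: eventually_mono)
  have "r < 1"
  proof -
    have "expectation (\<lambda>\<omega>. exp (- T 0 \<omega>)) < expectation (\<lambda>\<omega>. 1)"
    proof (rule integral_less_AE_space)
      show "AE \<omega> in M. exp (- T 0 \<omega>) < 1" using T_pos[of 0] by eventually_elim simp
    qed (use e_int emeasure_space_1 in auto)
    then show ?thesis by (simp add: r prob_space)
  qed
  define q where "q = exp (- u)"
  have q: "0 \<le> q" "q \<le> 1" "(sqrt q)\<^sup>2 = q" using assms(3) by (simp_all add: q_def)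
  obtain K where K: "\<And>x. x \<le> t \<Longrightarrow> \<bar>causal_mgf lam \<alpha> (sqrt q) x\<bar> \<le> K"
    using causal_mgf_bounded[OF assms(1)] by blast
  have "moment_gen M N u t = expectation (\<lambda>\<omega>. q ^ card {n. 1 \<le> n \<and> (\<Sum>i<n. T i \<omega>) \<le> t})"
    unfolding moment_gen_def
    by (intro Bochner_Integration.integral_cong) (simp_all add: N q_def mult.commute flip: exp_of_nat_mult)
  also have "\<dots> = causal_mgf lam \<alpha> (sqrt q) t"
  proof (rule expectation_power_renewal_count[OF ind T_pos r \<open>r < 1\<close> q(1,2) assms(4) _ _ K])
    show "expectation (\<lambda>\<omega>. q * causal_mgf lam \<alpha> (sqrt q) (x - T i \<omega>) - indicator {0..} (x - T i \<omega>)) =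
        causal_mgf lam \<alpha> (sqrt q) x - indicator {0..} x" for i x
      using causal_mgf_renewal_equation[OF assms(1), of lam "sqrt q" x]
        ex[of "\<lambda>s. q * causal_mgf lam \<alpha> (sqrt q) (x - s) - indicator {0..} (x - s)" i]
      by (simp add: q(3))
  qed (auto simp: causal_mgf_def[of _ _ _ "_::real"])
  finally show ?thesis by (simp add: q_def)
qed

text \<open>
  The partial fractions of $m$. At $t = 0$ the two weights add up to $1$.
\<close>

lemma causal_mgf_closed_form:
  assumes "0 < \<alpha>" "0 \<le> t" "p \<noteq> 0"
  shows "causal_mgf lam \<alpha> p t =
    (p + 1) / (2 * p) * mittag_leffler \<alpha> 1 (- lam * (1 - p) * t powr \<alpha>) +
    (p - 1) / (2 * p) * mittag_leffler \<alpha> 1 (- lam * (1 + p) * t powr \<alpha>)"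
proof (cases "t = 0")
  case True
  have "(p + 1) / (2 * p) + (p - 1) / (2 * p) = 1" using assms(3) by (simp add: field_simps)
  then show ?thesis using True by (simp add: causal_mgf_def mittag_leffler_0)
next
  case False
  then have t: "0 < t" using assms(2) by simp
  have "0 < fps_conv_radius (fps_const a * geom_fps x)" for a x
    by (intro fps_conv_radius_mult_pos fps_conv_radius_geom_pos) simp
  then show ?thesis
    using t assms
    by (simp only: causal_mgf_def if_True mgf_fps_partial_fractions[OF assms(3)] mittag_leffler_eq_rl_series
        rl_series_add rl_series_cmult fps_conv_radius_geom_pos)
qed

section \<open>Caputo derivatives\<close>

text \<open>
  The constant $1$ is represented by the kernel of order $1$, whose derivative is the kernel of order $0$ and hence vanishes. What
  remains has a factor $X^2$, which raises the order to $2\alpha$ and so keeps the first derivative integrable at $0$, and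
  also the second one if $\alpha > 1/2$.
\<close>

lemma rl_series_one_plus_X2_derivatives:
  assumes "0 < \<alpha>" "0 < fps_conv_radius a"
    and F: "\<forall>s>0. F s = rl_series \<alpha> 1 (1 + fps_X\<^sup>2 * a) s" and t: "0 < t"
  shows "(F has_real_derivative rl_series \<alpha> (2 * \<alpha>) a t) (at t)"
    and "(deriv F has_real_derivative rl_series \<alpha> (2 * \<alpha> - 1) a t) (at t)"
proof -
  have rad: "0 < fps_conv_radius (fps_X\<^sup>2 * a)" 
    using assms(2) by (intro fps_conv_radius_mult_pos) auto
  have first: "(F has_real_derivative rl_series \<alpha> (2 * \<alpha>) a s) (at s)" if s: "0 < s" for s
  proof -
    have "rl_series \<alpha> 0 (1 + fps_X\<^sup>2 * a) s = rl_series \<alpha> 0 1 s + rl_series \<alpha> 0 (fps_X\<^sup>2 * a) s"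
      using assms(1) s rad by (intro rl_series_add) auto
    also have "\<dots> = rl_series \<alpha> (2 * \<alpha>) a s"
      using assms s by (simp add: rl_series_one rl_series_X2_mult rl_kernel_def)
    finally have "(rl_series \<alpha> 1 (1 + fps_X\<^sup>2 * a) has_real_derivative rl_series \<alpha> (2 * \<alpha>) a s) (at s)"
      using rl_series_has_derivative[OF assms(1) _ s, of "1 + fps_X\<^sup>2 * a" 1] rad
      by (simp add: fps_conv_radius_add_pos)
    then show ?thesis
      by (rule has_field_derivative_transform_within_open[where S = "{0<..}"]) (use s F in auto)
  qed
  show "(F has_real_derivative rl_series \<alpha> (2 * \<alpha>) a t) (at t)" by (rule first[OF t])
  show "(deriv F has_real_derivative rl_series \<alpha> (2 * \<alpha> - 1) a t) (at t)"
    using rl_series_has_derivative[OF assms(1,2) t]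
    by (rule has_field_derivative_transform_within_open[where S = "{0<..}"])
       (use t in \<open>auto simp: DERIV_imp_deriv[OF first]\<close>)
qed

text \<open>
  Differentiating once or twice and then integrating fractionally lowers the order by exactly $\gamma$ altogether. If the
  power series had a linear term, its second derivative would be of order $\alpha - 1 \le 0$, which is not
  integrable at $0$ for $\alpha < 1$.
\<close>

lemma caputo_rl_series:
  assumes "0 < \<alpha>" "\<alpha> \<le> 1" "0 < fps_conv_radius a"
    and F: "\<forall>s>0. F s = rl_series \<alpha> 1 (1 + fps_X\<^sup>2 * a) s" and t: "0 < t"
    and \<gamma>: "0 < \<gamma>" "\<gamma> \<le> 2 * \<alpha>"
  shows "caputo_differentiable \<gamma> F t" and "caputo \<gamma> F t = rl_series \<alpha> (2 * \<alpha> - \<gamma> + 1) a t"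
proof -
  note d1 = rl_series_one_plus_X2_derivatives(1)[OF assms(1,3) F]
  note d2 = rl_series_one_plus_X2_derivatives(2)[OF assms(1,3) F]
  note D1 = DERIV_imp_deriv[OF d1] and D2 = DERIV_imp_deriv[OF d2]
  have fd1: "F field_differentiable (at s)" and fd2: "deriv F field_differentiable (at s)" if "0 < s" for s
    using d1[OF that] d2[OF that] by (auto simp: field_differentiable_def)
  have "caputo_differentiable \<gamma> F t \<and> caputo \<gamma> F t = rl_series \<alpha> (2 * \<alpha> - \<gamma> + 1) a t"
  proof -
    consider "\<gamma> < 1" | "\<gamma> = 1" | "1 < \<gamma>" "\<gamma> < 2" | "\<gamma> = 2" using \<gamma> assms(2) by linarith
    then show ?thesis
    proof cases
      case 1
      have "0 < 2 * \<alpha>" "0 < 1 - \<gamma>" using 1 assms by auto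
      note I = rl_series_fractional_integral[OF assms(1) this assms(3) t]
      have "set_integrable lborel {0<..<t} (\<lambda>s. (t - s) powr (- \<gamma>) * deriv F s)"
        using I(1) by (rule set_integrable_cong[THEN iffD1, rotated 3]) (auto simp: D1)
      moreover have "(LINT s:{0<..<t}|lborel. (t - s) powr (- \<gamma>) * deriv F s) =
          (LINT s:{0<..<t}|lborel. (t - s) powr (1 - \<gamma> - 1) * rl_series \<alpha> (2 * \<alpha>) a s)"
        by (rule set_lebesgue_integral_cong) (auto simp: D1)
      ultimately show ?thesis
        using 1 \<gamma> fd1 I(2) by (simp add: caputo_def caputo_differentiable_def algebra_simps)
    next
      case 2
      then show ?thesis using fd1[OF t] D1[OF t] by (simp add: caputo_def caputo_differentiable_def)
    next
      case 3
      have "0 < 2 * \<alpha> - 1" "0 < 2 - \<gamma>" using 3 \<gamma> assms by auto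
      note I = rl_series_fractional_integral[OF assms(1) this assms(3) t]
      have "set_integrable lborel {0<..<t} (\<lambda>s. (t - s) powr (1 - \<gamma>) * deriv (deriv F) s)"
        using I(1) by (rule set_integrable_cong[THEN iffD1, rotated 3]) (auto simp: D2)
      moreover have "(LINT s:{0<..<t}|lborel. (t - s) powr (1 - \<gamma>) * deriv (deriv F) s) =
          (LINT s:{0<..<t}|lborel. (t - s) powr (2 - \<gamma> - 1) * rl_series \<alpha> (2 * \<alpha> - 1) a s)"
        by (rule set_lebesgue_integral_cong) (auto simp: D2)
      ultimately show ?thesis
        using 3 fd1 fd2 I(2) by (simp add: caputo_def caputo_differentiable_def algebra_simps)
    next
      case 4
      have "\<forall>\<^sub>F s in nhds t. F field_differentiable (at s)"
        using t fd1 eventually_nhds_in_open[of "{0<..}" t] by (auto elim!: eventually_mono)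
      then show ?thesis
        using 4 t fd2[OF t] D2[OF t] by (simp add: caputo_def caputo_differentiable_def)
    qed
  qed
  then show "caputo_differentiable \<gamma> F t" "caputo \<gamma> F t = rl_series \<alpha> (2 * \<alpha> - \<gamma> + 1) a t" by auto
qed

text \<open>
  As $m$ has no linear term, the function differs from $1$ by at most a multiple of $t^{2\alpha}$ near $0$.
\<close>

lemma causal_mgf_derivative_0:
  assumes "1 / 2 < \<alpha>"
  shows "(causal_mgf lam \<alpha> p has_real_derivative 0) (at 0 within {0..})"
proof -
  let ?n = "mgf_tail_fps lam p"
  have \<alpha>: "0 < \<alpha>" using assms by simp
  define C where "C = (\<Sum>k. \<bar>fps_nth ?n k * rl_kernel (real k * \<alpha> + (2 * \<alpha> + 1)) 1\<bar>)"
  have G: "causal_mgf lam \<alpha> p t = 1 + rl_series \<alpha> (2 * \<alpha> + 1) ?n t" if "0 < t" for t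
  proof -
    have "rl_series \<alpha> 1 (mgf_fps lam p) t = rl_series \<alpha> 1 1 t + rl_series \<alpha> 1 (fps_X\<^sup>2 * ?n) t"
      unfolding mgf_fps_def using \<alpha> that
      by (intro rl_series_add fps_conv_radius_mult_pos mgf_tail_fps_pos) auto
    then show ?thesis
      using \<alpha> that by (simp add: causal_mgf_def rl_series_X2_mult mgf_tail_fps_pos rl_series_one
        rl_kernel_def rGamma_inverse_Gamma add.commute)
  qed
  have "((\<lambda>t. (causal_mgf lam \<alpha> p t - causal_mgf lam \<alpha> p 0) / (t - 0)) \<longlongrightarrow> 0) (at 0 within {0..})"
  proof (rule Lim_null_comparison)
    have "((\<lambda>t. C * t powr (2 * \<alpha> - 1)) \<longlongrightarrow> 0) (at_right 0)"
      using assms by real_asymp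
    then show "((\<lambda>t. C * t powr (2 * \<alpha> - 1)) \<longlongrightarrow> 0) (at 0 within {0..})"
      by (simp add: at_within_Ici_at_right)
    show "\<forall>\<^sub>F t in at 0 within {0..}. norm ((causal_mgf lam \<alpha> p t - causal_mgf lam \<alpha> p 0) / (t - 0))
        \<le> C * t powr (2 * \<alpha> - 1)"
      unfolding eventually_at
    proof (intro exI[of _ 1] conjI ballI impI)
      fix t :: real assume "t \<in> {0..}" "t \<noteq> 0 \<and> dist t 0 < 1"
      then have t: "0 < t" "t \<le> 1" by auto
      have "\<bar>rl_series \<alpha> (2 * \<alpha> + 1) ?n t\<bar> \<le> (t / 1) powr (2 * \<alpha> + 1 - 1) * C"
        unfolding C_def using \<alpha> t by (intro rl_series_bound mgf_tail_fps_pos) auto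
      then have "\<bar>rl_series \<alpha> (2 * \<alpha> + 1) ?n t\<bar> / t \<le> C * t powr (2 * \<alpha>) / t"
        using t by (intro divide_right_mono) (simp_all add: mult.commute)
      then show "norm ((causal_mgf lam \<alpha> p t - causal_mgf lam \<alpha> p 0) / (t - 0)) \<le> C * t powr (2 * \<alpha> - 1)"
        using t by (simp add: G) (simp add: causal_mgf_def powr_diff)
    qed simp
  qed
  then show ?thesis by (simp add: has_field_derivative_iff)
qed

theorem proposition3p3:
  fixes M :: "'a measure" and N :: "real \<Rightarrow> 'a \<Rightarrow> nat" and lam \<alpha> u :: real
  assumes "0 < lam" and "0 < \<alpha>" and "\<alpha> \<le> 1"
    and "renewal_process M (interarrival_density lam \<alpha>) N"
    and "0 \<le> u"
  shows "(\<forall>t>0. caputo_differentiable (2 * \<alpha>) (moment_gen M N u) t \<and>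
                caputo_differentiable \<alpha> (moment_gen M N u) t \<and>
                caputo (2 * \<alpha>) (moment_gen M N u) t + 2 * lam * caputo \<alpha> (moment_gen M N u) t
                  = lam\<^sup>2 * (exp (- u) - 1) * moment_gen M N u t) \<and>
         moment_gen M N u 0 = 1 \<and>
         (1 / 2 < \<alpha> \<longrightarrow> (moment_gen M N u has_real_derivative 0) (at 0 within {0..})) \<and>
         (\<forall>t\<ge>0. moment_gen M N u t =
            (sqrt (exp (- u)) + 1) / (2 * sqrt (exp (- u)))
              * mittag_leffler \<alpha> 1 (- lam * (1 - sqrt (exp (- u))) * t powr \<alpha>) +
            (sqrt (exp (- u)) - 1) / (2 * sqrt (exp (- u)))
              * mittag_leffler \<alpha> 1 (- lam * (1 + sqrt (exp (- u))) * t powr \<alpha>))"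
proof -
  define p where "p = sqrt (exp (- u))"
  have p: "p \<noteq> 0" "p\<^sup>2 = exp (- u)" by (simp_all add: p_def)
  let ?n = "mgf_tail_fps lam p"
  have eq: "moment_gen M N u t = causal_mgf lam \<alpha> p t" if "0 \<le> t" for t
    unfolding p_def using assms that by (intro moment_gen_eq_causal_mgf)
  have series: "\<forall>s>0. moment_gen M N u s = rl_series \<alpha> 1 (1 + fps_X\<^sup>2 * ?n) s"
    by (simp add: eq causal_mgf_def mgf_fps_def)
  have fde: "caputo_differentiable (2 * \<alpha>) (moment_gen M N u) t \<and>
                caputo_differentiable \<alpha> (moment_gen M N u) t \<and>
                caputo (2 * \<alpha>) (moment_gen M N u) t + 2 * lam * caputo \<alpha> (moment_gen M N u) t
                  = lam\<^sup>2 * (exp (- u) - 1) * moment_gen M N u t" if t: "0 < t" for t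
  proof -
    note C = caputo_rl_series[OF assms(2,3) mgf_tail_fps_pos series t]
    have rad: "0 < fps_conv_radius (fps_X * ?n)"
      by (intro fps_conv_radius_mult_pos mgf_tail_fps_pos) simp
    have "caputo (2 * \<alpha>) (moment_gen M N u) t + 2 * lam * caputo \<alpha> (moment_gen M N u) t =
        rl_series \<alpha> 1 ?n t + 2 * lam * rl_series \<alpha> (1 + \<alpha>) ?n t"
      using assms(2) C(2)[of "2 * \<alpha>"] C(2)[of \<alpha>] by (simp add: algebra_simps)
    also have "\<dots> = rl_series \<alpha> 1 (?n + fps_const (2 * lam) * (fps_X * ?n)) t"
      using assms(2) t rad
      by (simp add: rl_series_add rl_series_cmult rl_series_X_mult mgf_tail_fps_pos fps_conv_radius_mult_pos)
    also have "\<dots> = lam\<^sup>2 * (exp (- u) - 1) * moment_gen M N u t"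
      unfolding mgf_fps_fde using assms(2) t 
      by (simp add: rl_series_cmult mgf_fps_pos p eq causal_mgf_def)
    finally show ?thesis
      using C(1)[of "2 * \<alpha>"] C(1)[of \<alpha>] assms(2) by simp
  qed
  have "(moment_gen M N u has_real_derivative 0) (at 0 within {0..})" if "1 / 2 < \<alpha>"
    using causal_mgf_derivative_0[OF that, of lam p]
    by (rule has_field_derivative_transform_within[where d = 1]) (auto simp: eq)
  moreover have "moment_gen M N u 0 = 1" by (simp add: eq causal_mgf_def)
  ultimately show ?thesis
    using fde assms(2) causal_mgf_closed_form[OF assms(2) _ p(1)] by (simp add: eq flip: p_def)
qed

end
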